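(* Let $\Pi=\mathbb{R}/\mathbb{Z}$ be the circle, and let $\sigma,b\in C^2(\Pi)$ with $a:=\sigma^2/2>0$. Assume that $b$ takes both positive and negative values, that $b$ has finitely many zeros $x_1,\dots,x_n$, and that each zero $x_i$ of $b$ is either of finite order $m_i\ge1$ or flat. Then the functionals $I_\varepsilon$ $\Gamma$-converge to $J$ as $\varepsilon\to0$ with respect to the weak topology on the space $P(\Pi)$ of probability measures on $\Pi$.
   Context: A zero $x_i$ of $b$ is of finite order $m_i\ge1$ if $b$ is $C^{m_i}$ in a neighborhood of $x_i$, $b(x_i)=\dots=b^{(m_i-1)}(x_i)=0$ and $b^{(m_i)}(x_i)\ne0$. It is flat if $b$ is $C^\infty$ in a neighborhood of $x_i$ and $b^{(k)}(x_i)=0$ for all $k\in\mathbb{N}$. For $\varepsilon>0$ and $\mu\in P(\Pi)$, $$I_\varepsilon(\mu):=\sup_{u\in C^2(\Pi),\,u>0}\;-\int_\Pi\frac{\varepsilon\,a\,u''+b\,u'}{u}\,d\mu .$$ For $c\in C^0(\Pi)$, let $\lambda_\varepsilon^c$ be the principal eigenvalue (the eigenvalue with maximal real part) of the operator $u\mapsto\varepsilon\,a\,u''+b\,u'+c\,u$ on $\Pi$. Let $\Lambda(c):=\lim_{\varepsilon\to0}\lambda_\varepsilon^c$ (this limit exists under the present assumptions), and $$J(\mu):=\sup_{c\in C^0(\Pi)}\Bigl\{\int_\Pi c\,d\mu-\Lambda(c)\Bigr\}.$$ Weak convergence $\mu_\varepsilon\rightharpoonup\mu$ means $\int_\Pi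 f\,d\mu_\varepsilon\to\int_\Pi f\,d\mu$ for all $f\in C^0(\Pi)$. $\Gamma$-convergence of $I_\varepsilon$ to $J$ means that for every $\mu\in P(\Pi)$: (i) for every $(\mu_\varepsilon)$ in $P(\Pi)$ with $\mu_\varepsilon\rightharpoonup\mu$, $J(\mu)\le\liminf_{\varepsilon\to0}I_\varepsilon(\mu_\varepsilon)$; and (ii) there exists $(\mu_\varepsilon)$ in $P(\Pi)$ with $\mu_\varepsilon\rightharpoonup\mu$ and $J(\mu)\ge\limsup_{\varepsilon\to0}I_\varepsilon(\mu_\varepsilon)$ (along any sequence $\varepsilon\to0$). *)

theory Defs
  imports "HOL-Probability.Probability"
begin

text \<open>
  The circle is \<open>\<Pi> = \<real>/\<int>\<close>.  Functions on \<open>\<Pi>\<close> are represented by 1-periodic functions on the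
  real line, and Borel probability measures on \<open>\<Pi>\<close> by Borel probability measures on the real line
  carried by the fundamental domain \<open>[0,1)\<close>; both correspondences are bijective, and they respect
  integration.  The topology of \<open>\<Pi>\<close> enters through the test functions: these are periodic, so
  that for instance Dirac masses at \<open>1 - 1/n\<close> converge weakly to the Dirac mass at \<open>0\<close>.
\<close>

primrec nderiv :: "nat \<Rightarrow> (real \<Rightarrow> 'a::real_normed_vector) \<Rightarrow> real \<Rightarrow> 'a" where
  "nderiv 0 f = f"
| "nderiv (Suc k) f = (\<lambda>x. vector_derivative (nderiv k f) (at x))"

text \<open>Intended for open \<open>S\<close> only. The differentiability clause is needed because
  \<^const>\<open>vector_derivative\<close> is total.\<close>

definition Ck_on :: "nat \<Rightarrow> real set \<Rightarrow> (real \<Rightarrow> 'a::real_normed_vector) \<Rightarrow> bool" where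
  "Ck_on k S f \<longleftrightarrow>
     (\<forall>j<k. \<forall>x\<in>S. nderiv j f differentiable (at x)) \<and> continuous_on S (nderiv k f)"

definition C_circle :: "nat \<Rightarrow> (real \<Rightarrow> 'a::real_normed_vector) set" where
  "C_circle k = {f. (\<forall>x. f (x + 1) = f x) \<and> Ck_on k UNIV f}"

definition zero_of_order :: "(real \<Rightarrow> real) \<Rightarrow> real \<Rightarrow> nat \<Rightarrow> bool" where
  "zero_of_order b x m \<longleftrightarrow>
     m \<ge> 1 \<and> (\<exists>S. open S \<and> x \<in> S \<and> Ck_on m S b) \<and>
     (\<forall>j<m. nderiv j b x = 0) \<and> nderiv m b x \<noteq> 0"

definition flat_zero :: "(real \<Rightarrow> real) \<Rightarrow> real \<Rightarrow> bool" where
  "flat_zero b x \<longleftrightarrow>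
     (\<exists>S. open S \<and> x \<in> S \<and> (\<forall>k. Ck_on k S b)) \<and> (\<forall>k. nderiv k b x = 0)"

definition P_circle :: "real measure set" where
  "P_circle = {\<mu>. real_distribution \<mu> \<and> measure \<mu> {0..<1} = 1}"

definition weak_conv_circle :: "(nat \<Rightarrow> real measure) \<Rightarrow> real measure \<Rightarrow> bool" where
  "weak_conv_circle \<mu>s \<mu> \<longleftrightarrow>
     (\<forall>f \<in> (C_circle 0 :: (real \<Rightarrow> real) set).
        (\<lambda>k. \<integral>x. f x \<partial>\<mu>s k) \<longlonglongrightarrow> (\<integral>x. f x \<partial>\<mu>))"

definition I_fun ::
  "(real \<Rightarrow> real) \<Rightarrow> (real \<Rightarrow> real) \<Rightarrow> real \<Rightarrow> real measure \<Rightarrow> ereal" where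
  "I_fun a b \<epsilon> \<mu> =
     (SUP u \<in> {u \<in> C_circle 2. \<forall>x. u x > 0}.
        ereal (- (\<integral>x. (\<epsilon> * a x * nderiv 2 u x + b x * nderiv 1 u x) / u x \<partial>\<mu>)))"

text \<open>Eigenvalues may be non-real, so the operator acts on complex-valued functions.\<close>

definition circle_op ::
  "(real \<Rightarrow> real) \<Rightarrow> (real \<Rightarrow> real) \<Rightarrow> (real \<Rightarrow> real) \<Rightarrow> real \<Rightarrow> (real \<Rightarrow> complex) \<Rightarrow> real \<Rightarrow> complex" where
  "circle_op a b c \<epsilon> u =
     (\<lambda>x. of_real (\<epsilon> * a x) * nderiv 2 u x + of_real (b x) * nderiv 1 u x + of_real (c x) * u x)"

definition circle_eigenvalues ::
  "(real \<Rightarrow> real) \<Rightarrow> (real \<Rightarrow> real) \<Rightarrow> (real \<Rightarrow> real) \<Rightarrow> real \<Rightarrow> complex set" where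
  "circle_eigenvalues a b c \<epsilon> =
     {z. \<exists>u \<in> C_circle 2. (\<exists>x. u x \<noteq> 0) \<and> (\<forall>x. circle_op a b c \<epsilon> u x = z * u x)}"

text \<open>The eigenvalue of maximal real part is in fact unique and real; \<^const>\<open>Re\<close> only changes the
  type.\<close>

definition principal_eigenvalue ::
  "(real \<Rightarrow> real) \<Rightarrow> (real \<Rightarrow> real) \<Rightarrow> (real \<Rightarrow> real) \<Rightarrow> real \<Rightarrow> real" where
  "principal_eigenvalue a b c \<epsilon> = Re (ARG_MAX Re z. z \<in> circle_eigenvalues a b c \<epsilon>)"

definition Lambda :: "(real \<Rightarrow> real) \<Rightarrow> (real \<Rightarrow> real) \<Rightarrow> (real \<Rightarrow> real) \<Rightarrow> real" where
  "Lambda a b c = Lim (at_right 0) (principal_eigenvalue a b c)"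

definition J_fun :: "(real \<Rightarrow> real) \<Rightarrow> (real \<Rightarrow> real) \<Rightarrow> real measure \<Rightarrow> ereal" where
  "J_fun a b \<mu> = (SUP c \<in> C_circle 0. ereal ((\<integral>x. c x \<partial>\<mu>) - Lambda a b c))"

text \<open>\<open>\<Gamma>\<close>-convergence as \<open>\<epsilon> \<rightarrow> 0\<^sup>+\<close> on the space of probability measures on the circle, required
  along every positive sequence \<open>e k \<rightarrow> 0\<close>.\<close>

definition Gamma_converges ::
  "(real \<Rightarrow> real measure \<Rightarrow> ereal) \<Rightarrow> (real measure \<Rightarrow> ereal) \<Rightarrow> bool" where
  "Gamma_converges F G \<longleftrightarrow>
     (\<forall>e :: nat \<Rightarrow> real. (\<forall>k. e k > 0) \<and> e \<longlonglongrightarrow> 0 \<longrightarrow>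
       (\<forall>\<mu> \<in> P_circle.
         (\<forall>\<mu>s. (\<forall>k. \<mu>s k \<in> P_circle) \<and> weak_conv_circle \<mu>s \<mu> \<longrightarrow>
            G \<mu> \<le> liminf (\<lambda>k. F (e k) (\<mu>s k))) \<and>
         (\<exists>\<mu>s. (\<forall>k. \<mu>s k \<in> P_circle) \<and> weak_conv_circle \<mu>s \<mu> \<and>
            limsup (\<lambda>k. F (e k) (\<mu>s k)) \<le> G \<mu>)))"

end

theory Submission
  imports Defs "HOL-Complex_Analysis.Great_Picard"
begin

text \<open>
  The key point is the formula \<open>\<Lambda>(c) = max (c(z) - b'(z)\<^sup>+)\<close>, the maximum being taken over the zeros
  \<open>z\<close> of \<open>b\<close>, together with the existence of the limit defining \<open>\<Lambda>\<close>.  The upper bound comes from an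
  explicit positive supersolution \<open>exp (- F / \<epsilon>)\<close>; the lower bound from measures concentrated at scale
  \<open>sqrt \<epsilon>\<close> around \<open>z\<close>, whose density is the squared ground state of a harmonic oscillator, cut off.
  Testing \<open>I\<^sub>\<epsilon>\<close> with a positive eigenfunction gives \<open>\<integral> c d\<mu> - \<lambda>\<^sub>\<epsilon>\<^sup>c \<le> I\<^sub>\<epsilon>(\<mu>)\<close>, hence the liminf
  inequality.  For the limsup inequality, \<open>J(\<mu>) = \<infinity>\<close> unless \<open>\<mu>\<close> is carried by the zeros of \<open>b\<close>, in
  which case \<open>J(\<mu>) \<ge> \<integral> b'\<^sup>+ d\<mu>\<close> and mixtures of the concentrated measures form a recovery sequence.
\<close>

section \<open>Functions on the circle and first-order equations\<close>

text \<open>Origin of the term b'(z)^+: with x = z + sqrt(eps) y, the operator near a zero z tends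
  to a(z) d^2/dy^2 + b'(z) y d/dy + c(z), an Ornstein-Uhlenbeck generator plus a constant. If b'(z)
  < 0 the zero is attracting and mass stays there at no cost; if b'(z) > 0 it is repelling and mass
  is lost at rate b'(z). At a degenerate zero b'(z) = 0 and the limiting cost is 0. Two obstacles
  shape the proof. First, \<open>principal_eigenvalue\<close> is a choice among complex numbers, so
  it can be estimated only once a positive eigenfunction is found and shown to dominate every
  complex eigenvalue. This leads to a Perron argument for a resolvent that factors into two
  first-order periodic equations, whose maximum principle is elementary, and to a comparison based
  on the maximum of |v|^2/u^2. Second, \<open>I_fun\<close> is a supremum over all positive u, so a
  recovery measure must be estimated uniformly in u: an integration by parts and a completed square
  remove u'/u and leave an energy of the square root of the density alone.\<close>

lemma periodic_add_int:
  fixes f :: "real \<Rightarrow> 'a"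
  assumes "\<And>x. f (x + 1) = f x"
  shows "f (x + of_int n) = f x"
proof (induction n rule: int_induct[of _ 0])
  case base
  show ?case by simp
next
  case (step1 i)
  then show ?case using assms[of "x + of_int i"] by (simp add: algebra_simps)
next
  case (step2 i)
  then show ?case using assms[of "x + of_int (i - 1)"] by (simp add: algebra_simps)
qed

lemma periodic_frac:
  fixes f :: "real \<Rightarrow> 'a"
  assumes "\<And>x. f (x + 1) = f x"
  shows "f (frac x) = f x"
  using periodic_add_int[of f x "- \<lfloor>x\<rfloor>", OF assms] by (simp add: frac_def)

lemma C_circle_0_iff: "f \<in> C_circle 0 \<longleftrightarrow> (\<forall>x. f (x + 1) = f x) \<and> continuous_on UNIV f"
  by (simp add: C_circle_def Ck_on_def)

lemma C_circle_0_frac: "f \<in> C_circle 0 \<Longrightarrow> f (frac x) = f x"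
  by (simp add: C_circle_0_iff periodic_frac)

lemma C_circle_0_const: "(\<lambda>_. k) \<in> C_circle 0"
  by (simp add: C_circle_0_iff)

lemma C_circle_0_arith:
  fixes f g :: "real \<Rightarrow> real"
  assumes "f \<in> C_circle 0" "g \<in> C_circle 0"
  shows "(\<lambda>x. f x + g x) \<in> C_circle 0" "(\<lambda>x. f x - g x) \<in> C_circle 0"
    "(\<lambda>x. f x * g x) \<in> C_circle 0" "(\<lambda>x. max (f x) (g x)) \<in> C_circle 0"
    "(\<And>x. g x \<noteq> 0) \<Longrightarrow> (\<lambda>x. f x / g x) \<in> C_circle 0"
  using assms by (auto simp: C_circle_0_iff intro!: continuous_intros)

lemma C_circle_0_attains_sup:
  fixes f :: "real \<Rightarrow> real"
  assumes "f \<in> C_circle 0"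
  obtains x where "x \<in> {0..1}" "\<And>y. f y \<le> f x"
proof -
  have "continuous_on {0..1} f"
    using assms by (auto simp: C_circle_0_iff intro: continuous_on_subset)
  then obtain x where x: "x \<in> {0..1}" "\<forall>y\<in>{0..1}. f y \<le> f x"
    using continuous_attains_sup[of "{0..1::real}" f] by auto
  have "f y \<le> f x" for y
  proof -
    have "frac y \<in> {0..1}" using frac_lt_1[of y] by (auto intro: less_imp_le)
    then show ?thesis using x C_circle_0_frac[OF assms, of y] by metis
  qed
  then show ?thesis using x that by blast
qed

lemma C_circle_0_attains_inf:
  fixes f :: "real \<Rightarrow> real"
  assumes "f \<in> C_circle 0"
  obtains x where "x \<in> {0..1}" "\<And>y. f x \<le> f y"
proof -
  have "(\<lambda>x. - f x) \<in> C_circle 0"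
    using assms by (auto simp: C_circle_0_iff intro!: continuous_intros)
  then show ?thesis using that by (rule C_circle_0_attains_sup) auto
qed

lemma C_circle_0_bounded:
  fixes f :: "real \<Rightarrow> real"
  assumes "f \<in> C_circle 0"
  obtains M where "M > 0" "\<And>x. \<bar>f x\<bar> \<le> M"
proof -
  have "(\<lambda>x. \<bar>f x\<bar>) \<in> C_circle 0"
    using assms by (auto simp: C_circle_0_iff intro!: continuous_intros)
  then obtain x where x: "\<And>y. \<bar>f y\<bar> \<le> \<bar>f x\<bar>" by (rule C_circle_0_attains_sup) auto
  show ?thesis by (rule that[of "\<bar>f x\<bar> + 1"]) (auto intro: order_trans[OF x])
qed

lemma has_vector_derivative_shift_iff:
  fixes g :: "real \<Rightarrow> 'a::real_normed_vector"
  shows "((\<lambda>y. g (y + c)) has_vector_derivative D) (at x) \<longleftrightarrow> (g has_vector_derivative D) (at (x + c))"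
    (is "?L \<longleftrightarrow> ?R")
proof
  assume ?R
  have "((\<lambda>y. y + c) has_vector_derivative 1) (at x)" by (auto intro!: derivative_eq_intros)
  from vector_diff_chain_at[OF this, of g D] \<open>?R\<close> show ?L by (simp add: o_def)
next
  assume ?L
  have "((\<lambda>y. y - c) has_vector_derivative 1) (at (x + c))" by (auto intro!: derivative_eq_intros)
  from vector_diff_chain_at[OF this, of "\<lambda>y. g (y + c)" D] \<open>?L\<close> show ?R by (simp add: o_def)
qed

text \<open>Differentiability is not assumed: \<open>vector_derivative\<close> is a choice from the
  predicate \<open>has_vector_derivative\<close>, and by periodicity that predicate is the same at
  \<open>x\<close> and at \<open>x + 1\<close>.\<close>

lemma nderiv_periodic:
  fixes f :: "real \<Rightarrow> 'a::real_normed_vector"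
  assumes "\<And>x. f (x + 1) = f x"
  shows "nderiv k f (x + 1) = nderiv k f x"
proof (induction k arbitrary: x)
  case 0
  then show ?case using assms by simp
next
  case (Suc k)
  have "((nderiv k f) has_vector_derivative D) (at (x + 1)) \<longleftrightarrow> (nderiv k f has_vector_derivative D) (at x)" for D
    using has_vector_derivative_shift_iff[of "nderiv k f" 1 D x] Suc by (simp add: fun_eq_iff)
  then show ?case by (simp add: vector_derivative_def)
qed

lemma C_circle_has_vector_derivative:
  assumes "f \<in> C_circle k" "j < k"
  shows "(nderiv j f has_vector_derivative nderiv (Suc j) f x) (at x)"
  using assms by (auto simp: C_circle_def Ck_on_def vector_derivative_works[symmetric])

lemma C_circle_nderiv:
  fixes f :: "real \<Rightarrow> 'a::real_normed_vector"
  assumes "f \<in> C_circle k" "j \<le> k"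
  shows "nderiv j f \<in> C_circle 0"
proof -
  have "continuous_on UNIV (nderiv j f)"
  proof (cases "j = k")
    case True
    then show ?thesis using assms by (auto simp: C_circle_def Ck_on_def)
  next
    case False
    then have "j < k" using assms by simp
    then show ?thesis
      using C_circle_has_vector_derivative[OF assms(1)]
      by (meson continuous_at_imp_continuous_on has_vector_derivative_continuous)
  qed
  moreover have "nderiv j f (x + 1) = nderiv j f x" for x
    using assms by (intro nderiv_periodic) (auto simp: C_circle_def)
  ultimately show ?thesis by (simp add: C_circle_0_iff)
qed

lemma C_circle_2D:
  fixes u :: "real \<Rightarrow> 'a::real_normed_vector"
  assumes "u \<in> C_circle 2"
  shows "u \<in> C_circle 0" "nderiv 1 u \<in> C_circle 0" "nderiv 2 u \<in> C_circle 0"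
    "(u has_vector_derivative nderiv 1 u x) (at x)"
    "(nderiv 1 u has_vector_derivative nderiv 2 u x) (at x)"
  using C_circle_nderiv[OF assms, of 0] C_circle_nderiv[OF assms, of 1] C_circle_nderiv[OF assms, of 2]
    C_circle_has_vector_derivative[OF assms, of 0 x] C_circle_has_vector_derivative[OF assms, of 1 x]
  by (simp_all add: numeral_2_eq_2)

lemma C_circle_2D_real:
  fixes u :: "real \<Rightarrow> real"
  assumes "u \<in> C_circle 2"
  shows "(u has_real_derivative nderiv 1 u x) (at x)"
    "(nderiv 1 u has_real_derivative nderiv 2 u x) (at x)"
  using C_circle_2D(4,5)[OF assms] by (simp_all add: has_real_derivative_iff_has_vector_derivative)

lemma C_circle_2I:
  fixes u :: "real \<Rightarrow> 'a::real_normed_vector"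
  assumes "\<And>x. u (x + 1) = u x"
    and d1: "\<And>x. (u has_vector_derivative u' x) (at x)"
    and d2: "\<And>x. (u' has_vector_derivative u'' x) (at x)"
    and "continuous_on UNIV u''"
  shows "u \<in> C_circle 2" "nderiv 1 u = u'" "nderiv 2 u = u''"
proof -
  show 1: "nderiv 1 u = u'" using d1 by (auto simp: vector_derivative_at)
  then have 2: "nderiv 2 u = u''" using d2 by (auto simp: numeral_2_eq_2 vector_derivative_at)
  then show "nderiv 2 u = u''" .
  have "nderiv j u differentiable at x" if "j < 2" for j x
  proof -
    have "j = 0 \<or> j = 1" using that by auto
    then show ?thesis using d1[of x] d2[of x] 1 by (metis differentiableI_vector nderiv.simps(1))
  qed
  then show "u \<in> C_circle 2" using assms 2 by (auto simp: C_circle_def Ck_on_def)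
qed

lemma second_derivative_at_max:
  fixes f f' :: "real \<Rightarrow> real"
  assumes d1: "\<And>x. (f has_real_derivative f' x) (at x)"
    and d2: "(f' has_real_derivative D) (at x)" and max: "\<And>y. f y \<le> f x"
  shows "f' x = 0" "D \<le> 0"
proof -
  show 0: "f' x = 0" using DERIV_local_max[OF d1[of x], of 1] max by auto
  show "D \<le> 0"
  proof (rule ccontr)
    assume "\<not> D \<le> 0"
    then obtain d where d: "d > 0" "\<And>h. 0 < h \<Longrightarrow> h < d \<Longrightarrow> f' x < f' (x + h)"
      using DERIV_pos_inc_right[OF d2] by auto
    have "f' t > 0" if "x < t" "t < x + d / 2" for t
      using d(2)[of "t - x"] that d(1) 0 by simp
    then have "\<exists>D. (f has_real_derivative D) (at t) \<and> D > 0" if "x < t" "t < x + d / 2" for t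
      using d1 that by blast
    moreover have "continuous_on {x..x + d/2} f"
      by (rule DERIV_continuous_on) (rule has_field_derivative_at_within[OF d1])
    ultimately have "f x < f (x + d / 2)"
      using d(1) by (intro DERIV_pos_imp_increasing_open[of x "x + d/2" f]) simp_all
    then show False using max[of "x + d/2"] by simp
  qed
qed

section \<open>First-order linear equations with periodic coefficients and their maximum
  principle\<close>

lemma antiderivative_exists:
  fixes f :: "real \<Rightarrow> real"
  assumes "continuous_on UNIV f"
  shows "\<exists>F. \<forall>x. (F has_real_derivative f x) (at x)"
proof -
  have "\<exists>F. \<forall>x. -\<infinity> < ereal x \<longrightarrow> ereal x < \<infinity> \<longrightarrow> (F has_vector_derivative f x) (at x)"
    using assms by (intro einterval_antiderivative) (auto simp: continuous_on_eq_continuous_at)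
  then show ?thesis by (auto simp: has_real_derivative_iff_has_vector_derivative)
qed

lemma periodic_antiderivative:
  fixes f F :: "real \<Rightarrow> real"
  assumes "\<And>x. (F has_real_derivative f x) (at x)" "\<And>x. f (x + 1) = f x"
  shows "F (x + 1) = F x + (F 1 - F 0)"
proof -
  have "((\<lambda>x. F (x + 1) - F x) has_real_derivative 0) (at x)" for x
    using assms(2)
    by (auto intro!: derivative_eq_intros DERIV_chain2[OF assms(1)] assms(1))
  from DERIV_isconst_all[of "\<lambda>x. F (x + 1) - F x", rule_format, OF this, of x 0] show ?thesis by simp
qed

lemma first_order_periodic_solution:
  fixes g f :: "real \<Rightarrow> real"
  assumes g: "g \<in> C_circle 0" "\<And>x. g x > 0" and f: "f \<in> C_circle 0"
  obtains z where "z \<in> C_circle 0" "\<And>x. (z has_real_derivative (f x - g x * z x)) (at x)"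
proof -
  obtain G where G: "\<And>x. (G has_real_derivative g x) (at x)"
    using antiderivative_exists[of g] g by (auto simp: C_circle_0_iff)
  have contG: "continuous_on UNIV G"
    using G by (meson continuous_at_imp_continuous_on DERIV_isCont)
  have "continuous_on UNIV (\<lambda>x. exp (G x) * f x)"
    using f contG by (auto simp: C_circle_0_iff intro!: continuous_intros)
  from antiderivative_exists[OF this]
  obtain F where F: "\<And>x. (F has_real_derivative exp (G x) * f x) (at x)" by blast
  have "\<exists>D. (G has_real_derivative D) (at x) \<and> D > 0" for x using G g by blast
  then have "G 0 < G 1" by (intro DERIV_pos_imp_increasing[of 0 1 G]) simp_all
  define q where "q = exp (G 1 - G 0)"
  have q: "q > 1" using \<open>G 0 < G 1\<close> by (simp add: q_def)
  have Gp: "G (x + 1) = G x + (G 1 - G 0)" for x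
    by (rule periodic_antiderivative[OF G]) (use g in \<open>simp add: C_circle_0_iff\<close>)
  \<comment> \<open>The shift by 1 multiplies F' = exp G f by \<open>q\<close>, so \<open>F\<close>
    itself is transformed by an affine map with slope \<open>q\<close>.\<close>
  have Fp: "F (x + 1) = q * F x + (F 1 - q * F 0)" for x
  proof -
    have "((\<lambda>x. F (x + 1) - q * F x) has_real_derivative 0) (at x)" for x
      using f
      by (auto intro!: derivative_eq_intros DERIV_chain2[OF F] F
          simp: Gp exp_add exp_diff q_def C_circle_0_iff)
    from DERIV_isconst_all[of "\<lambda>x. F (x + 1) - q * F x", rule_format, OF this, of x 0]
    show ?thesis by simp
  qed
  \<comment> \<open>\<open>- k\<close> is the fixed point of that affine map, which exists because
    \<open>q > 1\<close>. Hence \<open>F + k\<close> is multiplied by exactly \<open>q\<close>, and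
    the factor \<open>exp (- G x)\<close> cancels it.\<close>
  define k where "k = (F 1 - q * F 0) / (q - 1)"
  have k: "F 1 - q * F 0 = (q - 1) * k" using q by (simp add: k_def)
  define z where "z x = exp (- G x) * (F x + k)" for x
  have d: "(z has_real_derivative (f x - g x * z x)) (at x)" for x
    unfolding z_def
    by (auto intro!: derivative_eq_intros G F simp: algebra_simps exp_minus field_simps)
  have "z (x + 1) = z x" for x
  proof -
    have "F (x + 1) + k = q * (F x + k)" using k Fp[of x] by (simp add: algebra_simps)
    moreover have "exp (- G (x + 1)) * q = exp (- G x)"
      unfolding q_def mult_exp_exp by (simp add: Gp)
    ultimately show ?thesis unfolding z_def by (metis mult.assoc)
  qed
  moreover have "continuous_on UNIV z" using d by (meson continuous_at_imp_continuous_on DERIV_isCont)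
  ultimately show ?thesis using that d by (auto simp: C_circle_0_iff)
qed

text \<open>Maximum principle: at a maximum \<open>y\<close> of \<open>z\<close> the derivative
  vanishes, so \<open>g y * z y = f y\<close>. The assumption \<open>M \<ge> 0\<close> settles the
  case of a negative maximum, where \<open>g y\<close> cannot be replaced by its lower bound
  \<open>g0\<close>.\<close>

lemma first_order_bound:
  fixes g f z :: "real \<Rightarrow> real"
  assumes z: "z \<in> C_circle 0" "\<And>x. (z has_real_derivative (f x - g x * z x)) (at x)"
    and g: "\<And>x. g x \<ge> g0" "g0 > 0" and f: "\<And>x. f x \<le> M" and M: "M \<ge> 0"
  shows "z x \<le> M / g0"
proof -
  obtain y where y: "\<And>x. z x \<le> z y" using C_circle_0_attains_sup[OF z(1)] by blast
  have "f y - g y * z y = 0" using DERIV_local_max[OF z(2)[of y], of 1] y by auto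
  then have *: "g y * z y \<le> M" using f[of y] by simp
  have "z y \<le> M / g0"
  proof (cases "z y \<ge> 0")
    case True
    then have "g0 * z y \<le> g y * z y" using g by (intro mult_right_mono) auto
    then show ?thesis using * g(2) by (simp add: field_simps)
  next
    case False
    then show ?thesis using M g(2) by (smt (verit) divide_nonneg_pos)
  qed
  then show ?thesis using y[of x] by simp
qed

lemma first_order_nonneg:
  fixes g f z :: "real \<Rightarrow> real"
  assumes z: "z \<in> C_circle 0" "\<And>x. (z has_real_derivative (f x - g x * z x)) (at x)"
    and g: "\<And>x. g x \<ge> g0" "g0 > 0" and f: "\<And>x. f x \<ge> 0"
  shows "z x \<ge> 0"
proof -
  have "- z x \<le> 0 / g0"
  proof (rule first_order_bound[where z = "\<lambda>x. - z x" and f = "\<lambda>x. - f x" and g = g])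
    show "(\<lambda>x. - z x) \<in> C_circle 0"
      using z(1) by (auto simp: C_circle_0_iff intro!: continuous_intros)
    show "((\<lambda>x. - z x) has_real_derivative - f x - g x * - z x) (at x)" for x
      by (auto intro!: derivative_eq_intros z(2))
  qed (use g f in auto)
  then show ?thesis by simp
qed

text \<open>A zero \<open>y\<close> of \<open>z\<close> would force \<open>z = 0\<close> on \<open>]-\<infinity>, y]\<close>, because \<open>e\<^sup>G z\<close> is nondecreasing when \<open>G' = g\<close>.\<close>

lemma first_order_pos:
  fixes g f z :: "real \<Rightarrow> real"
  assumes z: "z \<in> C_circle 0" "\<And>x. (z has_real_derivative (f x - g x * z x)) (at x)"
    and g: "g \<in> C_circle 0" "\<And>x. g x \<ge> g0" "g0 > 0" and f: "\<And>x. f x \<ge> 0" "f x0 > 0"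
  shows "z x > 0"
proof (rule ccontr)
  have nn: "z x \<ge> 0" for x using first_order_nonneg[OF z g(2,3) f(1)] .
  assume "\<not> z x > 0"
  with nn[of x] have zx: "z x = 0" by simp
  obtain G where G: "\<And>x. (G has_real_derivative g x) (at x)"
    using antiderivative_exists[of g] g by (auto simp: C_circle_0_iff)
  have *: "z y = 0" if "y \<le> x" for y
  proof -
    have "exp (G y) * z y \<le> exp (G x) * z x"
    proof (rule DERIV_nonneg_imp_nondecreasing[OF that])
      fix t
      have "((\<lambda>t. exp (G t) * z t) has_real_derivative exp (G t) * f t) (at t)"
        by (auto intro!: derivative_eq_intros G z(2) simp: algebra_simps)
      then show "\<exists>D. ((\<lambda>t. exp (G t) * z t) has_real_derivative D) (at t) \<and> 0 \<le> D"
        using f by (intro exI[of _ "exp (G t) * f t"]) auto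
    qed
    then have "exp (G y) * z y \<le> 0" using zx by simp
    then show ?thesis using nn[of y] by (simp add: mult_le_0_iff)
  qed
  \<comment> \<open>A shift by an integer brings any point to the left of \<open>x\<close>, where
    \<open>z\<close> is already known to vanish.\<close>
  have z0: "z y = 0" for y
  proof -
    have "z (y + of_int (\<lfloor>x\<rfloor> - \<lceil>y\<rceil>)) = z y"
      by (rule periodic_add_int) (use z in \<open>simp add: C_circle_0_iff\<close>)
    moreover have "y + of_int (\<lfloor>x\<rfloor> - \<lceil>y\<rceil>) \<le> x" by simp linarith
    ultimately show ?thesis using * by metis
  qed
  then have "z = (\<lambda>_. 0)" by auto
  then have "((\<lambda>_. 0) has_real_derivative f x0) (at x0)" using z(2)[of x0] by simp
  then have "f x0 = 0" using DERIV_const DERIV_unique by blast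
  then show False using f by simp
qed

section \<open>A Perron theorem for a linear pencil\<close>

text \<open>The set \<open>E\<close> consists of the \<open>\<lambda>\<close> admitting a nonzero subsolution.  At its supremum a subsolution
  \<open>v\<close> survives by compactness; if \<open>T ((m - \<lambda> w) v) \<noteq> v\<close>, strong positivity makes \<open>y = T ((m - \<lambda> w) v)\<close>
  a uniformly strict subsolution, so that \<open>\<lambda>\<close> could be increased.\<close>

lemma perron_pencil:
  fixes T :: "(real \<Rightarrow> real) \<Rightarrow> real \<Rightarrow> real"
  assumes T_C: "\<And>f. f \<in> C_circle 0 \<Longrightarrow> T f \<in> C_circle 0"
    and T_diff: "\<And>f g x. f \<in> C_circle 0 \<Longrightarrow> g \<in> C_circle 0 \<Longrightarrow> T (\<lambda>x. f x - g x) x = T f x - T g x"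
    and T_scale: "\<And>f k x. f \<in> C_circle 0 \<Longrightarrow> T (\<lambda>x. k * f x) x = k * T f x"
    and T_pos: "\<And>f x x0. f \<in> C_circle 0 \<Longrightarrow> (\<And>x. f x \<ge> 0) \<Longrightarrow> f x0 > 0 \<Longrightarrow> T f x > 0"
    and T_bound: "\<And>f M x. f \<in> C_circle 0 \<Longrightarrow> (\<And>x. \<bar>f x\<bar> \<le> M) \<Longrightarrow> \<bar>T f x\<bar> \<le> C * M"
    and T_lip: "\<And>f M x y. f \<in> C_circle 0 \<Longrightarrow> (\<And>x. \<bar>f x\<bar> \<le> M) \<Longrightarrow> \<bar>T f x - T f y\<bar> \<le> C * M * \<bar>x - y\<bar>"
    and C: "C > 0"
    and m: "m \<in> C_circle 0" and w: "w \<in> C_circle 0" "\<And>x. w x > 0"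
    and lohi: "lo \<le> hi"
    and lo: "\<And>x. T (\<lambda>x. m x - lo * w x) x \<ge> 1" and hi: "\<And>x. T (\<lambda>x. m x - hi * w x) x \<le> 1"
    and mpos: "\<And>x. m x - (hi + 1) * w x > 0"
  obtains l u where "u \<in> C_circle 0" "\<And>x. u x > 0" "\<And>x. T (\<lambda>x. (m x - l * w x) * u x) x = u x"
proof -
  define S where "S l u = (\<lambda>x. (m x - l * w x) * u x)" for l :: real and u :: "real \<Rightarrow> real"
  have SC: "S l u \<in> C_circle 0" if "u \<in> C_circle 0" for l u
    unfolding S_def by (intro C_circle_0_arith m w C_circle_0_const that)
  have mpos': "m x - l * w x > 0" if "l \<le> hi + 1" for l x
    using mpos[of x] mult_right_mono[OF that, of "w x"] w(2)[of x] by linarith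
  have T_nn: "T f x \<ge> 0" if "f \<in> C_circle 0" "\<And>x. f x \<ge> 0" for f x
  proof (cases "\<exists>x. f x > 0")
    case True
    then show ?thesis using T_pos[OF that(1)] that(2) by (metis less_imp_le)
  next
    case False
    then have "f = (\<lambda>x. 0 * f x)" using that(2) by (metis dual_order.antisym linorder_not_le mult_zero_left)
    then show ?thesis using T_scale[OF that(1), of 0 x] by simp
  qed
  have T_mono: "T f x \<le> T g x" if "f \<in> C_circle 0" "g \<in> C_circle 0" "\<And>x. f x \<le> g x" for f g x
    using T_nn[OF C_circle_0_arith(2)[OF that(2,1)], of x] T_diff[OF that(2,1), of x] that(3) by simp
  have T_strict: "T f x < T g x"
    if "f \<in> C_circle 0" "g \<in> C_circle 0" "\<And>x. f x \<le> g x" "f x0 < g x0" for f g x x0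
    using T_pos[OF C_circle_0_arith(2)[OF that(2,1)], of x0 x] T_diff[OF that(2,1), of x] that(3,4) by simp
  define sub where "sub l u \<longleftrightarrow> u \<in> C_circle 0 \<and> (\<forall>x. u x \<ge> 0) \<and> (\<exists>x. u x > 0) \<and> (\<forall>x. u x \<le> T (S l u) x)"
    for l u
  \<comment> \<open>The cap \<open>hi + 1\<close> keeps \<open>m - l * w\<close> positive, so that
    \<open>S l\<close> preserves order. Members of \<open>E\<close> turn out to be at most
    \<open>hi\<close>; the unit of room above \<open>hi\<close> is what later allows
    \<open>L + d\<close> with \<open>d \<le> 1\<close> to be a member.\<close>
  define E where "E = {l. lo \<le> l \<and> l \<le> hi + 1 \<and> (\<exists>u. sub l u)}"
  have "sub lo (\<lambda>_. 1)" using lo by (auto simp: sub_def S_def C_circle_0_const)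
  then have loE: "lo \<in> E" using lohi by (auto simp: E_def)
  \<comment> \<open>At a maximum \<open>y\<close> of a subsolution, \<open>u y\<close> is at most
    \<open>u y\<close> times \<open>T\<close> of the bare coefficient at \<open>l\<close>. For
    \<open>l > hi\<close> that factor is strictly below 1.\<close>
  have Ehi: "l \<le> hi" if "l \<in> E" for l
  proof (rule ccontr)
    assume "\<not> l \<le> hi"
    from that obtain u where u: "sub l u" "l \<le> hi + 1" by (auto simp: E_def)
    then have uC: "u \<in> C_circle 0" by (simp add: sub_def)
    from C_circle_0_attains_sup[OF uC] obtain y where y: "\<And>x. u x \<le> u y" by blast
    have "u y > 0" using u y by (metis sub_def order_less_le_trans)
    have c1: "(\<lambda>x. m x - k * w x) \<in> C_circle 0" for k
      by (intro C_circle_0_arith m w C_circle_0_const)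
    have c2: "(\<lambda>x. u y * (m x - k * w x)) \<in> C_circle 0" for k
      by (intro C_circle_0_arith m w C_circle_0_const)
    have "u y \<le> T (S l u) y" using u by (simp add: sub_def)
    also have "\<dots> \<le> T (\<lambda>x. u y * (m x - l * w x)) y"
      using y mpos'[OF u(2)]
      by (intro T_mono SC c2 uC) (auto simp: S_def mult.commute intro!: mult_left_mono less_imp_le)
    also have "\<dots> = u y * T (\<lambda>x. m x - l * w x) y" by (rule T_scale[OF c1])
    also have "\<dots> < u y * T (\<lambda>x. m x - hi * w x) y"
    proof (rule mult_strict_left_mono[OF _ \<open>u y > 0\<close>])
      have "l * w x > hi * w x" for x using \<open>\<not> l \<le> hi\<close> w(2)[of x] by simp
      then show "T (\<lambda>x. m x - l * w x) y < T (\<lambda>x. m x - hi * w x) y"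
        by (intro T_strict[of _ _ y] c1) (auto intro: less_imp_le)
    qed
    also have "\<dots> \<le> u y * 1" using hi \<open>u y > 0\<close> by (intro mult_left_mono) auto
    finally show False by simp
  qed
  have bdd: "bdd_above E" using Ehi by (auto simp: bdd_above_def)
  define L where "L = Sup E"
  have "L \<in> closure E" unfolding L_def using loE bdd by (intro closure_contains_Sup) auto
  then obtain l where l: "\<And>n. l n \<in> E" "l \<longlonglongrightarrow> L" by (auto simp: closure_sequential)
  have Lhi: "L \<le> hi" unfolding L_def using loE Ehi by (intro cSup_least) auto
  have loL: "lo \<le> L" unfolding L_def using loE bdd by (intro cSup_upper)
  \<comment> \<open>Normalising the maximum to 1 prevents the limit of the subsolutions from being
    0.\<close>
  have "\<exists>u x. sub (l n) u \<and> (\<forall>x. u x \<le> 1) \<and> x \<in> {0..1} \<and> u x = 1" for n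
  proof -
    from l(1)[of n] obtain u where u: "sub (l n) u" by (auto simp: E_def)
    then have uC: "u \<in> C_circle 0" by (simp add: sub_def)
    from C_circle_0_attains_sup[OF uC] obtain y where y: "y \<in> {0..1}" "\<And>x. u x \<le> u y" by blast
    have uy: "u y > 0" using u y by (metis sub_def order_less_le_trans)
    define u' where "u' x = inverse (u y) * u x" for x
    have u'C: "u' \<in> C_circle 0"
      unfolding u'_def[abs_def] by (intro C_circle_0_arith C_circle_0_const uC)
    have "T (S (l n) u') x = inverse (u y) * T (S (l n) u) x" for x
      using T_scale[OF SC[OF uC], of "inverse (u y)" "l n" x] by (simp add: S_def u'_def algebra_simps)
    then have "u' x \<le> T (S (l n) u') x" for x
      using u uy by (simp add: u'_def sub_def)
    moreover have "u' x \<ge> 0" "u' x \<le> 1" for x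
      using u uy y(2)[of x] by (auto simp: u'_def sub_def field_simps)
    moreover have "u' y = 1" using uy by (simp add: u'_def)
    ultimately show ?thesis using u'C y(1) unfolding sub_def by (metis zero_less_one)
  qed
  then obtain u p where u: "\<And>n. sub (l n) (u n)" "\<And>n x. u n x \<le> 1" and p: "\<And>n. p n \<in> {0..1}" "\<And>n. u n (p n) = 1"
    by metis
  have uC: "u n \<in> C_circle 0" and u0: "u n x \<ge> 0" for n x using u(1)[of n] by (auto simp: sub_def)
  \<comment> \<open>The \<open>u n\<close> need not have a common modulus of continuity. Their
    images under \<open>T\<close> have one by \<open>T_lip\<close>, so compactness is applied to
    \<open>v n\<close>, which lies above \<open>u n\<close>.\<close>
  define v where "v n = T (S (l n) (u n))" for n
  have vC: "v n \<in> C_circle 0" for n unfolding v_def by (intro T_C SC uC)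
  have uv: "u n x \<le> v n x" for n x using u(1)[of n] by (auto simp: sub_def v_def)
  have ln: "lo \<le> l n" "l n \<le> hi + 1" for n using l(1)[of n] by (auto simp: E_def)
  obtain A where A: "A > 0" "\<And>x. \<bar>m x\<bar> \<le> A" using C_circle_0_bounded[OF m] by blast
  obtain W where W: "W > 0" "\<And>x. \<bar>w x\<bar> \<le> W" using C_circle_0_bounded[OF w(1)] by blast
  define M where "M = A + (\<bar>lo\<bar> + \<bar>hi\<bar> + 1) * W"
  have M: "\<bar>m x - k * w x\<bar> \<le> M" if "lo \<le> k" "k \<le> hi + 1" for k x
  proof -
    have "\<bar>k * w x\<bar> \<le> (\<bar>lo\<bar> + \<bar>hi\<bar> + 1) * W"
      unfolding abs_mult using that W by (intro mult_mono) auto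
    with A(2)[of x] show ?thesis
      unfolding M_def by (rule order_trans[OF abs_triangle_ineq4 add_mono])
  qed
  have M0: "M > 0" using A W by (simp add: M_def add_pos_nonneg)
  have Sb: "\<bar>S (l n) (u n) x\<bar> \<le> M" for n x
    using mult_mono[OF M[OF ln, of x n], of "\<bar>u n x\<bar>" 1] u(2)[of n x] u0[of n x] M0
    by (simp add: S_def abs_mult)
  have vb: "\<bar>v n x\<bar> \<le> C * M" for n x unfolding v_def by (intro T_bound SC uC Sb)
  have vlip: "\<bar>v n x - v n y\<bar> \<le> C * M * \<bar>x - y\<bar>" for n x y unfolding v_def by (intro T_lip SC uC Sb)
  have CM: "C * M > 0" using C M0 by simp
  obtain g k where k: "strict_mono (k :: nat \<Rightarrow> nat)"
    and g: "\<And>e. 0 < e \<Longrightarrow> \<exists>N. \<forall>n x. n \<ge> N \<and> x \<in> {0..1} \<longrightarrow> norm (v (k n) x - g x) < e"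
  proof (rule Arzela_Ascoli[of "{0..1::real}" v "C * M"])
    show "\<exists>d>0. \<forall>n y. y \<in> {0..1} \<and> norm (x - y) < d \<longrightarrow> norm (v n x - v n y) < e" if "0 < e" for x e :: real
    proof (intro exI[of _ "e / (C * M)"] conjI allI impI)
      show "e / (C * M) > 0" using that CM by simp
      fix n y assume "y \<in> {0..1} \<and> norm (x - y) < e / (C * M)"
      then have "C * M * \<bar>x - y\<bar> < e" using CM by (simp add: field_simps)
      then show "norm (v n x - v n y) < e" using vlip[of n x y] by simp
    qed
  qed (use vb in \<open>auto simp del: of_nat_Suc\<close>)
  define V where "V x = g (frac x)" for x
  have vV: "\<exists>N. \<forall>n\<ge>N. \<forall>x. \<bar>v (k n) x - V x\<bar> < e" if "e > 0" for e
  proof -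
    from g[OF that] obtain N where N: "\<And>n x. n \<ge> N \<Longrightarrow> x \<in> {0..1} \<Longrightarrow> norm (v (k n) x - g x) < e" by blast
    have "\<bar>v (k n) x - V x\<bar> < e" if "n \<ge> N" for n x
      using N[OF that, of "frac x"] C_circle_0_frac[OF vC, of "k n" x] frac_lt_1[of x]
      by (simp add: V_def less_imp_le)
    then show ?thesis by blast
  qed
  have "uniform_limit UNIV (\<lambda>n. v (k n)) V sequentially"
    using vV by (auto simp: uniform_limit_iff eventually_sequentially dist_real_def)
  then have "continuous_on UNIV V"
    using vC by (intro uniform_limit_theorem[of _ "\<lambda>n. v (k n)"]) (auto simp: C_circle_0_iff)
  then have VC: "V \<in> C_circle 0" by (simp add: C_circle_0_iff V_def frac_1_eq)
  have eps: "a \<le> b" if "K > 0" "\<And>e. e > 0 \<Longrightarrow> a \<le> b + K * e" for a b K :: real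
  proof (rule field_le_epsilon)
    fix e :: real assume "e > 0"
    then show "a \<le> b + e" using that(2)[of "e / K"] that(1) by simp
  qed
  have V0: "V x \<ge> 0" for x
  proof (rule eps[of 1])
    fix e :: real assume "e > 0"
    from vV[OF this] obtain N where "\<bar>v (k N) x - V x\<bar> < e" by blast
    then show "0 \<le> V x + 1 * e" using uv[of "k N" x] u0[of "k N" x] by linarith
  qed simp
  \<comment> \<open>At \<open>p (k N)\<close> the approximant is at least 1, and the uniform error
    is below 1/2.\<close>
  obtain x1 where x1: "V x1 > 0"
  proof -
    from vV[of "1/2"] obtain N where "\<And>x. \<bar>v (k N) x - V x\<bar> < 1/2" by auto
    from this[of "p (k N)"] have "V (p (k N)) > 0"
      using uv[of "k N" "p (k N)"] p(2)[of "k N"] by linarith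
    then show ?thesis by (rule that)
  qed
  obtain B where B: "B > 0" "\<And>x. \<bar>V x\<bar> \<le> B" using C_circle_0_bounded[OF VC] by blast
  have lk: "(\<lambda>n. l (k n)) \<longlonglongrightarrow> L" using LIMSEQ_subseq_LIMSEQ[OF l(2) k] by (simp add: o_def)
  \<comment> \<open>Monotonicity turns \<open>u n \<le> v n\<close> into
    \<open>v n \<le> T (S (l n) (v n))\<close>. In the limit, \<open>v n\<close> contributes one
    error \<open>e\<close>, and replacing \<open>l n\<close>, \<open>v n\<close> by
    \<open>L\<close>, \<open>V\<close> inside \<open>T\<close> contributes
    \<open>C * (M + W * B) * e\<close>.\<close>
  have VT: "V x \<le> T (S L V) x" for x
  proof (rule eps[of "1 + C * (M + W * B)"])
    show "1 + C * (M + W * B) > 0" using C M0 W B by (intro add_pos_pos mult_pos_pos) auto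
    fix e :: real assume e: "e > 0"
    obtain N1 where N1: "\<And>n x. n \<ge> N1 \<Longrightarrow> \<bar>v (k n) x - V x\<bar> < e" using vV[OF e] by blast
    obtain N2 where N2: "\<And>n. n \<ge> N2 \<Longrightarrow> \<bar>l (k n) - L\<bar> < e" using LIMSEQ_D[OF lk e] by auto
    define n where "n = k (max N1 N2)"
    have n1: "\<bar>v n x - V x\<bar> \<le> e" for x using N1[of "max N1 N2" x] by (simp add: n_def)
    have n2: "\<bar>l n - L\<bar> \<le> e" using N2[of "max N1 N2"] by (simp add: n_def)
    have "\<bar>S (l n) (v n) y - S L V y\<bar> \<le> (M + W * B) * e" for y
    proof -
      have "S (l n) (v n) y - S L V y = (m y - l n * w y) * (v n y - V y) - (l n - L) * (w y * V y)"
        by (simp add: S_def algebra_simps)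
      also have "\<bar>\<dots>\<bar> \<le> \<bar>(m y - l n * w y) * (v n y - V y)\<bar> + \<bar>(l n - L) * (w y * V y)\<bar>"
        by (rule abs_triangle_ineq4)
      also have "\<dots> \<le> M * e + e * (W * B)"
        unfolding abs_mult using M[OF ln, of y n] n1[of y] n2 W B M0 e
        by (intro add_mono mult_mono) (auto intro: order.trans[OF abs_ge_zero])
      finally show ?thesis by (simp add: algebra_simps)
    qed
    then have "\<bar>T (\<lambda>x. S (l n) (v n) x - S L V x) x\<bar> \<le> C * ((M + W * B) * e)"
      by (intro T_bound C_circle_0_arith SC vC VC)
    then have T1: "T (S (l n) (v n)) x \<le> T (S L V) x + C * ((M + W * B) * e)"
      using T_diff[OF SC[OF vC] SC[OF VC], of "l n" n L x] by linarith
    have "T (S (l n) (u n)) x \<le> T (S (l n) (v n)) x"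
    proof (rule T_mono[OF SC[OF uC] SC[OF vC]])
      show "S (l n) (u n) t \<le> S (l n) (v n) t" for t
        using mult_left_mono[OF uv[of n t] less_imp_le[OF mpos'[OF ln(2)]]] by (simp add: S_def)
    qed
    then have "v n x \<le> T (S (l n) (v n)) x" by (simp add: v_def[of n])
    then have "V x \<le> T (S L V) x + C * ((M + W * B) * e) + e" using T1 n1[of x] by linarith
    then show "V x \<le> T (S L V) x + (1 + C * (M + W * B)) * e" by (simp add: algebra_simps)
  qed
  define y where "y = T (S L V)"
  have yC: "y \<in> C_circle 0" unfolding y_def by (intro T_C SC VC)
  have mL: "m x - L * w x > 0" for x using Lhi by (intro mpos') simp
  have y0: "y x > 0" for x
    unfolding y_def
  proof (rule T_pos[OF SC[OF VC]])
    show "S L V t \<ge> 0" for t using mL[of t] V0[of t] by (simp add: S_def)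
    show "S L V x1 > 0" using mL[of x1] x1 by (simp add: S_def)
  qed
  have "V = y"
  proof (rule ccontr)
    assume "V \<noteq> y"
    then obtain x2 where "V x2 \<noteq> y x2" by auto
    then have x2: "V x2 < y x2" using VT[of x2] by (simp add: y_def)
    define D where "D x = T (S L y) x - y x" for x
    have DC: "D \<in> C_circle 0" unfolding D_def[abs_def] by (intro C_circle_0_arith T_C SC yC)
    have D0: "D x > 0" for x
    proof -
      have "T (S L V) x < T (S L y) x"
      proof (rule T_strict[of "S L V" "S L y" x2 x])
        show "S L V t \<le> S L y t" for t
          using mL[of t] VT[of t] by (auto simp: S_def y_def intro!: mult_left_mono)
        show "S L V x2 < S L y x2" using mL[of x2] x2 by (simp add: S_def)
      qed (intro SC VC yC)+
      then show ?thesis by (simp add: D_def y_def)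
    qed
    obtain z where z: "\<And>x. D z \<le> D x" using C_circle_0_attains_inf[OF DC] by blast
    have wyC: "(\<lambda>x. w x * y x) \<in> C_circle 0" by (intro C_circle_0_arith w yC)
    from C_circle_0_bounded[OF wyC] obtain K where K: "K > 0" "\<And>x. \<bar>w x * y x\<bar> \<le> K" by blast
    \<comment> \<open>Raising \<open>L\<close> by \<open>d\<close> lowers \<open>T (S L y)\<close>
      by at most \<open>d * (C * K)\<close>, which must not exceed the minimum \<open>D z\<close> of
      the slack.\<close>
    define d where "d = min 1 (D z / (C * K))"
    have CK: "C * K > 0" using C K by simp
    have d: "d > 0" "d \<le> 1" "d * (C * K) \<le> D z"
    proof -
      show "d > 0" "d \<le> 1" using D0[of z] CK by (auto simp: d_def)
      have "d \<le> D z / (C * K)" by (simp add: d_def)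
      then show "d * (C * K) \<le> D z" using CK by (simp add: pos_le_divide_eq)
    qed
    have dwyC: "(\<lambda>x. d * (w x * y x)) \<in> C_circle 0" by (intro C_circle_0_arith wyC C_circle_0_const)
    have "y x \<le> T (S (L + d) y) x" for x
    proof -
      have "S (L + d) y = (\<lambda>x. S L y x - d * (w x * y x))" by (auto simp: S_def algebra_simps)
      then have "T (S (L + d) y) x = T (S L y) x - d * T (\<lambda>x. w x * y x) x"
        using T_diff[OF SC[OF yC] dwyC, of L x] T_scale[OF wyC, of d x] by simp
      moreover have "d * T (\<lambda>x. w x * y x) x \<le> d * (C * K)"
        using T_bound[OF wyC K(2), of x] d(1) by (intro mult_left_mono) auto
      ultimately show ?thesis using d(3) z[of x] by (simp add: D_def)
    qed
    then have "sub (L + d) y" using yC y0 by (auto simp: sub_def less_imp_le)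
    then have "L + d \<in> E" using d Lhi loL by (auto simp: E_def)
    then have "L + d \<le> L" unfolding L_def using bdd by (intro cSup_upper) (auto simp: L_def)
    then show False using d by simp
  qed
  then have "T (S L V) = V" unfolding y_def by (rule sym)
  then have "T (\<lambda>x. (m x - L * w x) * V x) x = V x" for x unfolding S_def by (rule fun_cong)
  then show ?thesis using that VC y0 \<open>V = y\<close> by blast
qed

section \<open>The principal eigenvalue\<close>

text \<open>\<open>u\<close> solves \<open>- u'' - B u' + K (K + B) u = f\<close>: the left-hand operator factors as
  \<open>- (d/dx + K + B) (d/dx - K)\<close>.\<close>

definition resolves :: "real \<Rightarrow> (real \<Rightarrow> real) \<Rightarrow> (real \<Rightarrow> real) \<Rightarrow> (real \<Rightarrow> real) \<Rightarrow> bool" where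
  "resolves K B f u \<longleftrightarrow> u \<in> C_circle 0 \<and> (\<exists>z \<in> C_circle 0.
     (\<forall>x. (z has_real_derivative (f x - (K + B x) * z x)) (at x)) \<and>
     (\<forall>x. (u has_real_derivative (K * u x - z x)) (at x)))"

lemma C_circle_0_reflect:
  fixes f :: "real \<Rightarrow> real"
  assumes "f \<in> C_circle 0"
  shows "(\<lambda>x. f (- x)) \<in> C_circle 0"
proof -
  have "f (- (x + 1)) = f (- x)" for x
    using assms C_circle_0_iff[of f] by (metis add.commute minus_add_cancel minus_add_distrib)
  moreover have "continuous_on UNIV (\<lambda>x. f (- x))"
    using assms by (auto simp: C_circle_0_iff intro!: continuous_on_compose2[of UNIV f] continuous_intros)
  ultimately show ?thesis by (simp add: C_circle_0_iff)
qed

lemma reflect_derivative: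
  assumes "\<And>x. (u has_real_derivative (K * u x - z x)) (at x)"
  shows "((\<lambda>x. u (- x)) has_real_derivative (z (- x) - K * u (- x))) (at x)"
  using assms[of "- x"] by (simp add: DERIV_mirror)

context
  fixes K :: real and B :: "real \<Rightarrow> real" and g0 :: real
  assumes K: "K > 0" and B: "B \<in> C_circle 0" and g0: "g0 > 0" "\<And>x. g0 \<le> K + B x"
begin

lemma resolves_exists:
  assumes f: "f \<in> C_circle 0"
  shows "\<exists>u. resolves K B f u"
proof -
  have gC: "(\<lambda>x. K + B x) \<in> C_circle 0" by (intro C_circle_0_arith C_circle_0_const B)
  have "K + B x > 0" for x using g0(1) g0(2)[of x] by simp
  from first_order_periodic_solution[OF gC this f]
  obtain z where z: "z \<in> C_circle 0" "\<And>x. (z has_real_derivative (f x - (K + B x) * z x)) (at x)"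
    by blast
  \<comment> \<open>In u' = K u - z the sign of \<open>K\<close> is opposite to that of the
    first-order theory; the reflection x -> -x corrects it.\<close>
  from first_order_periodic_solution[OF C_circle_0_const _ C_circle_0_reflect[OF z(1)], of K] K
  obtain u where u: "u \<in> C_circle 0" "\<And>x. (u has_real_derivative (z (- x) - K * u x)) (at x)"
    by blast
  have "((\<lambda>x. u (- x)) has_real_derivative (K * u (- x) - z x)) (at x)" for x
    using u(2)[of "- x"] by (simp add: DERIV_mirror)
  then show ?thesis using z C_circle_0_reflect[OF u(1)] unfolding resolves_def by blast
qed

lemma resolves_pos:
  assumes "resolves K B f u" "\<And>x. f x \<ge> 0" "f x0 > 0"
  shows "u x > 0"
proof -
  have gC: "(\<lambda>x. K + B x) \<in> C_circle 0" by (intro C_circle_0_arith C_circle_0_const B)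
  from assms(1) obtain z where z: "z \<in> C_circle 0" "\<And>x. (z has_real_derivative (f x - (K + B x) * z x)) (at x)"
    and u: "u \<in> C_circle 0" "\<And>x. (u has_real_derivative (K * u x - z x)) (at x)"
    by (auto simp: resolves_def)
  have zp: "z x > 0" for x by (rule first_order_pos[OF z gC g0(2,1) assms(2,3)])
  have "u (- (- x)) > 0"
    by (rule first_order_pos[OF C_circle_0_reflect[OF u(1)] reflect_derivative[OF u(2)] C_circle_0_const order.refl K])
      (use zp in \<open>auto intro: less_imp_le\<close>)
  then show ?thesis by simp
qed

text \<open>The first-order maximum principle is applied to each factor: \<open>z\<close> loses a
  factor \<open>g0\<close>, then the reflected \<open>u\<close> a factor \<open>K\<close>.\<close>

lemma resolves_bound:
  assumes "resolves K B f u" "\<And>x. f x \<le> M" "M \<ge> 0"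
  shows "u x \<le> M / (g0 * K)"
proof -
  from assms(1) obtain z where z: "z \<in> C_circle 0" "\<And>x. (z has_real_derivative (f x - (K + B x) * z x)) (at x)"
    and u: "u \<in> C_circle 0" "\<And>x. (u has_real_derivative (K * u x - z x)) (at x)"
    by (auto simp: resolves_def)
  have zp: "z x \<le> M / g0" for x by (rule first_order_bound[OF z g0(2,1) assms(2,3)])
  have "u (- (- x)) \<le> (M / g0) / K"
    by (rule first_order_bound[OF C_circle_0_reflect[OF u(1)] reflect_derivative[OF u(2)] order.refl K])
      (use zp g0 assms(3) in auto)
  then show ?thesis by simp
qed

lemma resolves_diff:
  assumes "resolves K B f u" "resolves K B h v"
  shows "resolves K B (\<lambda>x. f x - h x) (\<lambda>x. u x - v x)"
proof -
  from assms obtain y z where "z \<in> C_circle 0" "\<And>x. (z has_real_derivative (f x - (K + B x) * z x)) (at x)"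
      "u \<in> C_circle 0" "\<And>x. (u has_real_derivative (K * u x - z x)) (at x)"
      "y \<in> C_circle 0" "\<And>x. (y has_real_derivative (h x - (K + B x) * y x)) (at x)"
      "v \<in> C_circle 0" "\<And>x. (v has_real_derivative (K * v x - y x)) (at x)"
    unfolding resolves_def by blast
  note * = this
  show ?thesis unfolding resolves_def
    by (intro conjI bexI[of _ "\<lambda>x. z x - y x"] allI C_circle_0_arith *)
      (auto intro!: derivative_eq_intros * simp: algebra_simps)
qed

lemma resolves_scale:
  assumes "resolves K B f u"
  shows "resolves K B (\<lambda>x. k * f x) (\<lambda>x. k * u x)"
proof -
  from assms obtain z where "z \<in> C_circle 0" "\<And>x. (z has_real_derivative (f x - (K + B x) * z x)) (at x)"
      "u \<in> C_circle 0" "\<And>x. (u has_real_derivative (K * u x - z x)) (at x)"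
    unfolding resolves_def by blast
  note * = this
  show ?thesis unfolding resolves_def
    by (intro conjI bexI[of _ "\<lambda>x. k * z x"] allI C_circle_0_arith C_circle_0_const *)
      (auto intro!: derivative_eq_intros * simp: algebra_simps)
qed

lemma resolves_abs_bound:
  assumes "resolves K B f u" "\<And>x. \<bar>f x\<bar> \<le> M"
  shows "\<bar>u x\<bar> \<le> M / (g0 * K)"
proof -
  have M: "M \<ge> 0" using assms(2)[of 0] by simp
  have "f x \<le> M" "(- 1) * f x \<le> M" for x using assms(2)[of x] by auto
  from resolves_bound[OF assms(1) this(1) M, of x] resolves_bound[OF resolves_scale[OF assms(1)] this(2) M, of x]
  show ?thesis by (simp add: abs_le_iff)
qed

lemma resolves_unique:
  assumes "resolves K B f u" "resolves K B f v"
  shows "u = v"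
proof
  fix x
  from resolves_abs_bound[OF resolves_diff[OF assms], of 0 x] show "u x = v x" by simp
qed

text \<open>Each of the two terms of u' = K u - z is at most \<open>M / g0\<close> in absolute
  value. This is the equicontinuity that the Perron argument consumes.\<close>

lemma resolves_lipschitz:
  assumes "resolves K B f u" "\<And>x. \<bar>f x\<bar> \<le> M"
  shows "\<bar>u x - u y\<bar> \<le> 2 * M / g0 * \<bar>x - y\<bar>"
proof -
  from assms(1) obtain z where z: "z \<in> C_circle 0" "\<And>x. (z has_real_derivative (f x - (K + B x) * z x)) (at x)"
    and u: "u \<in> C_circle 0" "\<And>x. (u has_real_derivative (K * u x - z x)) (at x)"
    by (auto simp: resolves_def)
  have M: "M \<ge> 0" using assms(2)[of 0] by simp
  have f: "f x \<le> M" "- f x \<le> M" for x using assms(2)[of x] by auto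
  have z': "(\<lambda>x. - z x) \<in> C_circle 0" "((\<lambda>x. - z x) has_real_derivative (- f x - (K + B x) * - z x)) (at x)" for x
    using z by (auto simp: C_circle_0_iff intro!: derivative_eq_intros continuous_intros)
  have zb: "\<bar>z x\<bar> \<le> M / g0" for x
    using first_order_bound[OF z g0(2,1) f(1) M, of x] first_order_bound[OF z' g0(2,1) f(2) M, of x]
    by (simp add: abs_le_iff)
  have Ku: "\<bar>K * u x\<bar> \<le> M / g0" for x
    using mult_left_mono[OF resolves_abs_bound[OF assms, of x], of K] K g0(1) by (simp add: abs_mult)
  have "norm (u x - u y) \<le> (2 * M / g0) * norm (x - y)"
  proof (rule field_differentiable_bound[of UNIV])
    show "(u has_field_derivative (K * u x - z x)) (at x within UNIV)" for x using u by simp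
    show "norm (K * u x - z x) \<le> 2 * M / g0" for x using zb[of x] Ku[of x] by simp
  qed auto
  then show ?thesis by simp
qed

lemma resolves_second_order:
  assumes "resolves K B f u"
  obtains p where "\<And>x. (u has_real_derivative p x) (at x)"
    "\<And>x. (p has_real_derivative (K * (K + B x) * u x - B x * p x - f x)) (at x)"
proof -
  from assms obtain z where z: "\<And>x. (z has_real_derivative (f x - (K + B x) * z x)) (at x)"
    and u: "\<And>x. (u has_real_derivative (K * u x - z x)) (at x)"
    by (auto simp: resolves_def)
  show ?thesis
    by (rule that[of "\<lambda>x. K * u x - z x"])
      (auto intro!: derivative_eq_intros u z simp: algebra_simps)
qed

text \<open>Calibration: since the resolvent sends \<open>K * (K + B x)\<close> to 1, comparing
  coefficients with this function gives the hypotheses on \<open>lo\<close> and \<open>hi\<close> in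
  \<open>perron_pencil\<close>.\<close>

lemma resolves_const: "resolves K B (\<lambda>x. K * (K + B x)) (\<lambda>_. 1)"
  unfolding resolves_def
  by (intro conjI bexI[of _ "\<lambda>_. K"]) (auto simp: C_circle_0_const)

end

text \<open>Division by \<open>a\<close> turns the equation into - u'' - B u' + K (K + B) u = (m - l
  w) u with w = 1/a. The eigenvalue \<open>l\<close> then multiplies the weight \<open>w\<close>,
  which is why a linear pencil occurs rather than a plain eigenvalue problem for
  \<open>T\<close>.\<close>

lemma positive_eigenfunction:
  fixes a b c :: "real \<Rightarrow> real"
  assumes a: "a \<in> C_circle 0" "\<And>x. a x > 0" and b: "b \<in> C_circle 0" and c: "c \<in> C_circle 0"
  obtains u l where "u \<in> C_circle 2" "\<And>x. u x > 0"
    "\<And>x. a x * nderiv 2 u x + b x * nderiv 1 u x + c x * u x = l * u x"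
proof -
  define B where "B x = b x / a x" for x
  define w where "w x = 1 / a x" for x
  have an: "a x \<noteq> 0" for x using a(2)[of x] by simp
  have BC: "B \<in> C_circle 0" unfolding B_def[abs_def] by (intro C_circle_0_arith a b an)
  have wC: "w \<in> C_circle 0" unfolding w_def[abs_def] by (intro C_circle_0_arith a C_circle_0_const an)
  have w0: "w x > 0" for x using a by (simp add: w_def)
  have caC: "(\<lambda>x. c x * w x) \<in> C_circle 0" by (intro C_circle_0_arith c wC)
  obtain bB where bB: "bB > 0" "\<And>x. \<bar>B x\<bar> \<le> bB" using C_circle_0_bounded[OF BC] by blast
  obtain bw where bw: "bw > 0" "\<And>x. \<bar>w x\<bar> \<le> bw" using C_circle_0_bounded[OF wC] by blast
  obtain bc where bc: "bc > 0" "\<And>x. \<bar>c x\<bar> \<le> bc" using C_circle_0_bounded[OF c] by blast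
  \<comment> \<open>\<open>Q\<close> bounds (bc + 1 - c) w, and \<open>K\<close> is large enough for
    K (K + B) to be at least 1 + Q; together they give \<open>mpos\<close> for
    \<open>hi = bc\<close>.\<close>
  define Q where "Q = (2 * bc + 1) * bw"
  have Q: "Q > 0" using bw bc by (simp add: Q_def)
  define K where "K = bB + 1 + Q"
  have K: "K > 0" using bB Q by (simp add: K_def)
  have g0: "1 + Q \<le> K + B x" for x using bB(2)[of x] by (simp add: K_def abs_le_iff)
  have g0': "1 + Q > 0" using Q by simp
  note R = K BC g0' g0
  obtain T where T: "\<And>f. f \<in> C_circle 0 \<Longrightarrow> resolves K B f (T f)"
    using resolves_exists[OF R] by metis
  define m where "m x = K * (K + B x) + c x * w x" for x
  have mC: "m \<in> C_circle 0" unfolding m_def[abs_def] by (intro C_circle_0_arith C_circle_0_const BC caC)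
  have Teq: "T f = u" if "f \<in> C_circle 0" "resolves K B f u" for f u
    using resolves_unique[OF R T] that by blast
  have T_diff: "T (\<lambda>x. f x - g x) x = T f x - T g x" if "f \<in> C_circle 0" "g \<in> C_circle 0" for f g x
    using Teq[OF C_circle_0_arith(2)[OF that] resolves_diff[OF R T[OF that(1)] T[OF that(2)]]] by simp
  have T_scale: "T (\<lambda>x. k * f x) x = k * T f x" if "f \<in> C_circle 0" for f k x
    using Teq[OF C_circle_0_arith(3)[OF C_circle_0_const that] resolves_scale[OF R T[OF that]]] by simp
  define C where "C = max (1 / ((1 + Q) * K)) (2 / (1 + Q))"
  have C0: "C > 0" using g0' by (simp add: C_def less_max_iff_disj)
  have one: "T (\<lambda>x. K * (K + B x)) x = 1" for x
    by (subst Teq[OF _ resolves_const[OF R]]) (auto intro!: C_circle_0_arith C_circle_0_const BC)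
  have mono: "T f x \<le> T g x" if "f \<in> C_circle 0" "g \<in> C_circle 0" "\<And>x. f x \<le> g x" for f g x
    using resolves_bound[OF R resolves_diff[OF R T[OF that(1)] T[OF that(2)]], of 0 x] that(3) by simp
  have kC: "(\<lambda>x. m x - k * w x) \<in> C_circle 0" for k by (intro C_circle_0_arith mC wC C_circle_0_const)
  have KC: "(\<lambda>x. K * (K + B x)) \<in> C_circle 0" by (intro C_circle_0_arith BC C_circle_0_const)
  obtain l u where u: "u \<in> C_circle 0" "\<And>x. u x > 0" and Tu: "\<And>x. T (\<lambda>x. (m x - l * w x) * u x) x = u x"
  proof (rule perron_pencil[where T = T and m = m and w = w and lo = "- bc" and hi = bc and C = C])
    show "T f \<in> C_circle 0" if "f \<in> C_circle 0" for f using T[OF that] by (simp add: resolves_def)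
    show "T f x > 0" if "f \<in> C_circle 0" "\<And>x. f x \<ge> 0" "f x0 > 0" for f x x0
      by (rule resolves_pos[OF R T[OF that(1)] that(2,3)])
    fix f :: "real \<Rightarrow> real" and M x y :: real
    assume f: "f \<in> C_circle 0" "\<And>x. \<bar>f x\<bar> \<le> M"
    from f(2)[of x] have M: "M \<ge> 0" by (rule order_trans[OF abs_ge_zero])
    have "1 / ((1 + Q) * K) * M \<le> C * M" "2 / (1 + Q) * M * \<bar>x - y\<bar> \<le> C * M * \<bar>x - y\<bar>"
      using M by (auto simp only: C_def intro!: mult_right_mono)
    then show "\<bar>T f x\<bar> \<le> C * M" "\<bar>T f x - T f y\<bar> \<le> C * M * \<bar>x - y\<bar>"
      using resolves_abs_bound[OF R T[OF f(1)] f(2), of x] resolves_lipschitz[OF R T[OF f(1)] f(2), of x y]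
      by auto
  next
    fix x
    have "T (\<lambda>x. K * (K + B x)) x \<le> T (\<lambda>x. m x - (- bc) * w x) x"
    proof (rule mono[OF KC kC])
      show "K * (K + B x) \<le> m x - (- bc) * w x" for x
        using mult_right_mono[of "- bc" "c x" "w x"] bc(2)[of x] w0[of x] by (auto simp: m_def abs_le_iff)
    qed
    then show "1 \<le> T (\<lambda>x. m x - (- bc) * w x) x" using one by simp
    have "T (\<lambda>x. m x - bc * w x) x \<le> T (\<lambda>x. K * (K + B x)) x"
    proof (rule mono[OF kC KC])
      show "m x - bc * w x \<le> K * (K + B x)" for x
        using mult_right_mono[of "c x" bc "w x"] bc(2)[of x] w0[of x] by (auto simp: m_def abs_le_iff)
    qed
    then show "T (\<lambda>x. m x - bc * w x) x \<le> 1" using one by simp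
    have "K * (K + B x) \<ge> 1 * (1 + Q)"
      using g0[of x] Q bB by (intro mult_mono) (auto simp: K_def)
    moreover have "(bc + 1 - c x) * w x \<le> Q"
      unfolding Q_def using bc(2)[of x] bw(2)[of x] w0[of x] bc(1) by (intro mult_mono) (auto simp: abs_le_iff)
    ultimately show "0 < m x - (bc + 1) * w x" by (simp add: m_def algebra_simps)
  qed (use T_diff T_scale C0 mC wC w0 bc(1) in auto)
  have sC: "(\<lambda>x. (m x - l * w x) * u x) \<in> C_circle 0" by (intro C_circle_0_arith kC u)
  have "T (\<lambda>x. (m x - l * w x) * u x) = u" using Tu by auto
  then have "resolves K B (\<lambda>x. (m x - l * w x) * u x) u" using T[OF sC] by simp
  from resolves_second_order[OF R this] obtain p
    where p: "\<And>x. (u has_real_derivative p x) (at x)"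
      and p': "\<And>x. (p has_real_derivative (K * (K + B x) * u x - B x * p x - (m x - l * w x) * u x)) (at x)"
    by blast
  define q where "q x = K * (K + B x) * u x - B x * p x - (m x - l * w x) * u x" for x
  have q: "q x = (l - c x) * w x * u x - B x * p x" for x by (simp add: q_def m_def algebra_simps)
  have "continuous_on UNIV p" using p' by (meson continuous_at_imp_continuous_on DERIV_isCont)
  then have "continuous_on UNIV q"
    using u(1) wC BC c unfolding q C_circle_0_iff by (auto intro!: continuous_intros)
  then have D: "u \<in> C_circle 2" "nderiv 1 u = p" "nderiv 2 u = q"
    using C_circle_2I[of u p q] u(1) p p'
    by (auto simp: C_circle_0_iff has_real_derivative_iff_has_vector_derivative q_def)
  have "a x * nderiv 2 u x + b x * nderiv 1 u x + c x * u x = l * u x" for x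
    unfolding D using an[of x] by (simp add: q w_def B_def field_simps)
  then show ?thesis using that D(1) u(2) by blast
qed

text \<open>Let \<open>m\<close> be the maximum of |v|^2/u^2 for an eigenfunction v, attained at
  \<open>y\<close>. Then F = |v|^2 - m u^2 has maximum 0 at \<open>y\<close>, and F' = 0, F'' <= 0
  transfer the supersolution inequality from u to v. Splitting v into real and imaginary parts is
  what admits nonreal eigenvalues.\<close>

lemma eigenvalue_Re_le_supersolution:
  fixes a b c u :: "real \<Rightarrow> real" and z :: complex
  assumes u: "u \<in> C_circle 2" "\<And>x. u x > 0"
    and super: "\<And>x. \<epsilon> * a x * nderiv 2 u x + b x * nderiv 1 u x + c x * u x \<le> l * u x"
    and a: "\<epsilon> > 0" "\<And>x. a x > 0" and z: "z \<in> circle_eigenvalues a b c \<epsilon>"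
  shows "Re z \<le> l"
proof -
  from z obtain v x0 where v: "v \<in> C_circle 2" "v x0 \<noteq> 0"
    and ev: "\<And>x. circle_op a b c \<epsilon> v x = z * v x" by (auto simp: circle_eigenvalues_def)
  define g h g1 h1 g2 h2 where "g x = Re (v x)" "h x = Im (v x)" "g1 x = Re (nderiv 1 v x)"
    "h1 x = Im (nderiv 1 v x)" "g2 x = Re (nderiv 2 v x)" "h2 x = Im (nderiv 2 v x)" for x
  note defs = this
  note V = C_circle_2D(4,5)[OF v(1)]
  have d: "(g has_real_derivative g1 x) (at x)" "(h has_real_derivative h1 x) (at x)"
    "(g1 has_real_derivative g2 x) (at x)" "(h1 has_real_derivative h2 x) (at x)" for x
    unfolding defs[abs_def] by (intro has_field_derivative_Re has_field_derivative_Im V)+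
  note U = C_circle_2D_real[OF u(1)]
  define u1 u2 where "u1 = nderiv 1 u" and "u2 = nderiv 2 u"
  note U = U[folded u1_def u2_def]
  define N where "N x = ((g x)\<^sup>2 + (h x)\<^sup>2) / (u x)\<^sup>2" for x
  have un: "u x \<noteq> 0" for x using u(2)[of x] by simp
  have "N \<in> C_circle 0"
    using C_circle_2D(1)[OF v(1)] C_circle_2D(1)[OF u(1)] un
    unfolding C_circle_0_iff N_def[abs_def] defs
    by (auto intro!: continuous_intros)
  then obtain y where y: "\<And>x. N x \<le> N y" using C_circle_0_attains_sup by blast
  define m where "m = N y"
  have "N x0 > 0" using v(2) un[of x0]
    by (auto simp: N_def defs complex_eq_iff sum_power2_gt_zero_iff intro!: divide_pos_pos)
  then have m: "m > 0" using y[of x0] by (simp add: m_def)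
  define F where "F x = (g x)\<^sup>2 + (h x)\<^sup>2 - m * (u x)\<^sup>2" for x
  define F1 where "F1 x = 2 * (g x * g1 x + h x * h1 x - m * (u x * u1 x))" for x
  have F0: "F y = 0" using un by (simp add: F_def m_def N_def)
  have Fle: "F x \<le> F y" for x
  proof -
    have "((g x)\<^sup>2 + (h x)\<^sup>2) / (u x)\<^sup>2 \<le> m" using y[of x] by (simp add: m_def N_def[of x])
    then show ?thesis unfolding F0 using un[of x] by (simp add: F_def divide_le_eq)
  qed
  have D1: "(F has_real_derivative F1 x) (at x)" for x
    unfolding F_def[abs_def] F1_def by (auto intro!: derivative_eq_intros d U simp: algebra_simps)
  have D2: "(F1 has_real_derivative 2 * (g x * g2 x + (g1 x)\<^sup>2 + h x * h2 x + (h1 x)\<^sup>2 - m * (u x * u2 x + (u1 x)\<^sup>2))) (at x)" for x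
    unfolding F1_def[abs_def] by (auto intro!: derivative_eq_intros d U simp: algebra_simps power2_eq_square)
  from second_derivative_at_max[OF D1 D2 Fle]
  have e1: "g y * g1 y + h y * h1 y = m * (u y * u1 y)"
    and e2: "g y * g2 y + (g1 y)\<^sup>2 + h y * h2 y + (h1 y)\<^sup>2 \<le> m * (u y * u2 y + (u1 y)\<^sup>2)"
    by (auto simp: F1_def)
  have e0: "(g y)\<^sup>2 + (h y)\<^sup>2 = m * (u y)\<^sup>2" using F0 by (simp add: F_def)
  \<comment> \<open>Lagrange's identity for the vectors (g, h) and (g1, h1): \<open>e1\<close> gives
    their scalar product and \<open>e0\<close> the squared length of the first. The result absorbs
    the gradient terms of \<open>e2\<close>.\<close>
  have CS: "m * (u1 y)\<^sup>2 \<le> (g1 y)\<^sup>2 + (h1 y)\<^sup>2"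
  proof -
    have "(m * (u y * u1 y))\<^sup>2 + (g y * h1 y - h y * g1 y)\<^sup>2 = ((g y)\<^sup>2 + (h y)\<^sup>2) * ((g1 y)\<^sup>2 + (h1 y)\<^sup>2)"
      unfolding e1[symmetric] by (simp add: power2_eq_square algebra_simps)
    then have "(m * (u y)\<^sup>2) * (m * (u1 y)\<^sup>2) \<le> (m * (u y)\<^sup>2) * ((g1 y)\<^sup>2 + (h1 y)\<^sup>2)"
      unfolding e0 using zero_le_power2[of "g y * h1 y - h y * g1 y"] by (simp add: power_mult_distrib power2_eq_square algebra_simps)
    then show ?thesis using m un[of y] by (simp add: mult_le_cancel_left)
  qed
  define A where "A = \<epsilon> * a y"
  have A: "A > 0" using a by (simp add: A_def)
  have "A * g2 y + b y * g1 y + c y * g y = Re z * g y - Im z * h y"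
    "A * h2 y + b y * h1 y + c y * h y = Re z * h y + Im z * g y"
    using arg_cong[OF ev[of y], of Re] arg_cong[OF ev[of y], of Im] by (simp_all add: circle_op_def defs A_def)
  \<comment> \<open>Real part of the eigenvalue equation multiplied by the conjugate of v; the
    imaginary part of \<open>z\<close> cancels.\<close>
  then have E: "Re z * ((g y)\<^sup>2 + (h y)\<^sup>2) = A * (g y * g2 y + h y * h2 y) + b y * (g y * g1 y + h y * h1 y) + c y * ((g y)\<^sup>2 + (h y)\<^sup>2)"
    by algebra
  have "m * u y * (A * u2 y + b y * u1 y + c y * u y) \<le> m * u y * (l * u y)"
    using super[of y] m u(2)[of y] unfolding A_def u1_def u2_def by (intro mult_left_mono) auto
  moreover have "g y * g2 y + h y * h2 y \<le> m * (u y * u2 y)" using e2 CS by (simp add: algebra_simps)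
  then have "A * (g y * g2 y + h y * h2 y) \<le> A * (m * (u y * u2 y))" using A by (intro mult_left_mono) auto
  ultimately have "Re z * (m * (u y)\<^sup>2) \<le> l * (m * (u y)\<^sup>2)"
    using E unfolding e0 e1 by (simp add: power2_eq_square algebra_simps)
  then show ?thesis using m un[of y] by (simp add: mult_le_cancel_right)
qed

text \<open>A positive eigenfunction is a supersolution for its own eigenvalue \<open>l\<close>, so
  \<open>l\<close> bounds the real part of every eigenvalue. Thus the maximum behind
  \<open>ARG_MAX\<close> is attained, and whichever maximiser is chosen has real part
  \<open>l\<close>.\<close>

lemma principal_eigenfunction:
  fixes a b c :: "real \<Rightarrow> real"
  assumes a: "a \<in> C_circle 0" "\<And>x. a x > 0" and b: "b \<in> C_circle 0" and c: "c \<in> C_circle 0" and e: "\<epsilon> > 0"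
  obtains u where "u \<in> C_circle 2" "\<And>x. u x > 0"
    "\<And>x. \<epsilon> * a x * nderiv 2 u x + b x * nderiv 1 u x + c x * u x = principal_eigenvalue a b c \<epsilon> * u x"
    "of_real (principal_eigenvalue a b c \<epsilon>) \<in> circle_eigenvalues a b c \<epsilon>"
proof -
  have "(\<lambda>x. \<epsilon> * a x) \<in> C_circle 0" by (intro C_circle_0_arith a C_circle_0_const)
  from positive_eigenfunction[OF this _ b c] a(2) e obtain u l where u: "u \<in> C_circle 2" "\<And>x. u x > 0"
    and eq: "\<And>x. \<epsilon> * a x * nderiv 2 u x + b x * nderiv 1 u x + c x * u x = l * u x"
    by auto
  define v where "v x = complex_of_real (u x)" for x
  have v: "v \<in> C_circle 2" "nderiv 1 v = (\<lambda>x. of_real (nderiv 1 u x))" "nderiv 2 v = (\<lambda>x. of_real (nderiv 2 u x))"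
  proof -
    have "(v has_vector_derivative of_real (nderiv 1 u x)) (at x)"
      "((\<lambda>x. complex_of_real (nderiv 1 u x)) has_vector_derivative of_real (nderiv 2 u x)) (at x)" for x
      unfolding v_def[abs_def] using C_circle_2D_real[OF u(1), of x]
      by (simp_all add: has_vector_derivative_of_real has_real_derivative_iff_has_vector_derivative)
    moreover have "v (x + 1) = v x" for x using C_circle_2D(1)[OF u(1)] by (simp add: v_def C_circle_0_iff)
    moreover have "continuous_on UNIV (\<lambda>x. complex_of_real (nderiv 2 u x))"
      using C_circle_2D(3)[OF u(1)] by (auto simp: C_circle_0_iff intro!: continuous_intros)
    ultimately have "v \<in> C_circle 2 \<and> nderiv 1 v = (\<lambda>x. of_real (nderiv 1 u x)) \<and> nderiv 2 v = (\<lambda>x. of_real (nderiv 2 u x))"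
      using C_circle_2I[of v "\<lambda>x. of_real (nderiv 1 u x)" "\<lambda>x. of_real (nderiv 2 u x)"] by blast
    then show "v \<in> C_circle 2" "nderiv 1 v = (\<lambda>x. of_real (nderiv 1 u x))" "nderiv 2 v = (\<lambda>x. of_real (nderiv 2 u x))"
      by auto
  qed
  have "circle_op a b c \<epsilon> v x = of_real l * v x" for x
  proof -
    have "circle_op a b c \<epsilon> v x = of_real (\<epsilon> * a x * nderiv 2 u x + b x * nderiv 1 u x + c x * u x)"
      unfolding circle_op_def v by (simp add: v_def)
    then show ?thesis by (simp only: eq v_def of_real_mult)
  qed
  then have l: "complex_of_real l \<in> circle_eigenvalues a b c \<epsilon>"
    unfolding circle_eigenvalues_def using v(1) u(2) by (auto intro!: bexI[of _ v] exI[of _ 0] simp: v_def less_imp_neq[THEN not_sym])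
  have le: "Re z \<le> l" if "z \<in> circle_eigenvalues a b c \<epsilon>" for z
    by (rule eigenvalue_Re_le_supersolution[OF u _ e a(2) that]) (simp only: eq order_refl)
  define S where "S = circle_eigenvalues a b c \<epsilon>"
  have "is_arg_max Re (\<lambda>z. z \<in> S) (complex_of_real l)"
    using l le by (auto simp: is_arg_max_linorder S_def)
  then have "is_arg_max Re (\<lambda>z. z \<in> S) (ARG_MAX Re z. z \<in> S)"
    unfolding arg_max_def by (rule someI)
  then have "Re (ARG_MAX Re z. z \<in> S) = l"
    using l le by (force simp: is_arg_max_linorder S_def)
  then have "principal_eigenvalue a b c \<epsilon> = l" by (simp add: principal_eigenvalue_def S_def)
  then show ?thesis using that u eq l by simp
qed

lemma principal_eigenvalue_le_supersolution:
  fixes a b c u :: "real \<Rightarrow> real"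
  assumes "a \<in> C_circle 0" "\<And>x. a x > 0" "b \<in> C_circle 0" "c \<in> C_circle 0" "\<epsilon> > 0"
    and "u \<in> C_circle 2" "\<And>x. u x > 0"
    and "\<And>x. \<epsilon> * a x * nderiv 2 u x + b x * nderiv 1 u x + c x * u x \<le> l * u x"
  shows "principal_eigenvalue a b c \<epsilon> \<le> l"
proof -
  obtain v :: "real \<Rightarrow> real" where "of_real (principal_eigenvalue a b c \<epsilon>) \<in> circle_eigenvalues a b c \<epsilon>"
    using principal_eigenfunction[OF assms(1-5)] by blast
  from eigenvalue_Re_le_supersolution[OF assms(6-8,5,2) this] show ?thesis by simp
qed

section \<open>Upper bound for the principal eigenvalue\<close>

definition logistic :: "real \<Rightarrow> real" where
  "logistic t = 1 / (1 + exp (- t))"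

lemma logistic_pos: "logistic t > 0"
  by (simp add: logistic_def add_pos_pos)

lemma logistic_lt_1: "logistic t < 1"
  by (simp add: logistic_def add_pos_pos)

lemma logistic_derivative: "(logistic has_real_derivative logistic t * (1 - logistic t)) (at t)"
proof -
  have "1 + exp (- t) > 0" by (simp add: add_pos_pos)
  then show ?thesis
    unfolding logistic_def[abs_def]
    by (auto intro!: derivative_eq_intros simp: field_simps power2_eq_square)
qed

lemma continuous_on_logistic: "continuous_on A f \<Longrightarrow> continuous_on A (\<lambda>x. logistic (f x))"
  unfolding logistic_def by (intro continuous_intros) (auto simp: add_nonneg_eq_0_iff)

text \<open>The product approximates the positive part of \<open>y\<close> with an error that does
  not grow with \<open>y\<close>, because s exp(-s) <= 1. After the substitution y = t f and
  division by t the error is therefore O(1/t).\<close>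

lemma logistic_mult_ge:
  assumes "\<bar>k\<bar> \<le> K"
  shows "y * logistic (k + y) \<ge> max 0 y - exp K"
proof -
  define E where "E = exp (- (k + y))"
  have E: "E > 0" by (simp add: E_def)
  have ye: "s * exp (- s) \<le> 1" for s :: real
  proof -
    have "s \<le> exp s" using exp_ge_add_one_self[of s] by linarith
    then show ?thesis by (simp add: exp_minus field_simps)
  qed
  show ?thesis
  proof (cases "y \<ge> 0")
    case True
    have "logistic (k + y) = 1 / (1 + E)" by (simp add: logistic_def E_def)
    then have "y - y * logistic (k + y) = y * E / (1 + E)"
      using E by (simp add: field_simps)
    also have "\<dots> \<le> y * E" using E True by (simp add: field_simps)
    also have "\<dots> = y * exp (- y) * exp (- k)" by (simp add: E_def mult_exp_exp)
    also have "\<dots> \<le> 1 * exp K" using ye assms True by (intro mult_mono) auto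
    finally show ?thesis using True by simp
  next
    case False
    have "logistic (k + y) \<le> exp (k + y)"
    proof -
      have "logistic (k + y) = 1 / (1 + E)" by (simp add: logistic_def E_def)
      also have "\<dots> \<le> 1 / E" using E by (simp add: frac_le)
      also have "1 / E = exp (k + y)" unfolding E_def exp_minus by (metis inverse_eq_divide inverse_inverse_eq)
      finally show ?thesis .
    qed
    then have "- y * logistic (k + y) \<le> - y * exp (k + y)" using False by (intro mult_left_mono) auto
    also have "\<dots> = (- y) * exp (- (- y)) * exp k" by (simp add: exp_add)
    also have "\<dots> \<le> 1 * exp K" using ye[of "- y"] assms False by (intro mult_mono) auto
    finally show ?thesis using False by simp
  qed
qed

lemma C_circle_0_integrable:
  fixes f :: "real \<Rightarrow> real"
  shows "f \<in> C_circle 0 \<Longrightarrow> f integrable_on {s..t}"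
  by (auto simp: C_circle_0_iff intro!: integrable_continuous_real intro: continuous_on_subset)

text \<open>For large t the cutoff selects the region f > 0, so the integral approaches that of f^+
  w, which is positive by continuity.\<close>

lemma logistic_integral_pos:
  fixes f h w :: "real \<Rightarrow> real"
  assumes C: "f \<in> C_circle 0" "h \<in> C_circle 0" "w \<in> C_circle 0" and w: "\<And>x. w x > 0" and f: "f x0 > 0"
  shows "\<exists>t>0. integral {0..1} (\<lambda>x. logistic (h x + t * f x) * f x * w x) > 0"
proof -
  obtain K where K: "K > 0" "\<And>x. \<bar>h x\<bar> \<le> K" using C_circle_0_bounded[OF C(2)] by blast
  define P where "P = integral {0..1} (\<lambda>x. max 0 (f x) * w x)"
  define W where "W = integral {0..1} w"
  have fw: "(\<lambda>x. max 0 (f x) * w x) \<in> C_circle 0" by (intro C_circle_0_arith C C_circle_0_const)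
  have "P \<ge> 0" unfolding P_def using w by (intro integral_nonneg C_circle_0_integrable fw) (auto intro!: mult_nonneg_nonneg intro: less_imp_le)
  moreover have "P \<noteq> 0"
  proof
    assume "P = 0"
    then have "\<forall>x\<in>{0..1}. max 0 (f x) * w x = 0"
      unfolding P_def using w fw
      by (subst (asm) integral_eq_0_iff) (auto simp: C_circle_0_iff less_imp_le intro: continuous_on_subset)
    moreover have "frac x0 \<in> {0..1}" using frac_lt_1[of x0] by (auto intro: less_imp_le)
    ultimately have "max 0 (f (frac x0)) * w (frac x0) = 0" by blast
    then show False using C_circle_0_frac[OF C(1), of x0] f w[of "frac x0"] by simp
  qed
  ultimately have P: "P > 0" by simp
  have W: "W \<ge> 0" unfolding W_def using w by (intro integral_nonneg C_circle_0_integrable C) (auto intro: less_imp_le)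
  \<comment> \<open>With this \<open>t\<close> the error \<open>exp K / t * W\<close> equals P W /
    (W + 1), strictly less than \<open>P\<close>.\<close>
  define t where "t = exp K * (W + 1) / P"
  have t: "t > 0" using P W by (simp add: t_def)
  have i2: "(\<lambda>x. max 0 (f x) * w x - exp K / t * w x) integrable_on {0..1}"
    by (intro C_circle_0_integrable C_circle_0_arith fw C C_circle_0_const)
  have "logistic (h x + t * f x) * f x * w x \<ge> max 0 (f x) * w x - exp K / t * w x" for x
  proof -
    have "max 0 (t * f x) = t * max 0 (f x)" using t by (simp add: max_def zero_le_mult_iff)
    then have "t * max 0 (f x) - exp K \<le> t * (f x * logistic (h x + t * f x))"
      using logistic_mult_ge[OF K(2), of "t * f x" x] by (simp add: mult.assoc)
    then have "max 0 (f x) - exp K / t \<le> f x * logistic (h x + t * f x)"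
      using t by (simp add: field_simps)
    from mult_right_mono[OF this, of "w x"] w[of x] show ?thesis by (simp add: algebra_simps)
  qed
  moreover have "(\<lambda>x. logistic (h x + t * f x) * f x * w x) \<in> C_circle 0"
    using C by (auto simp: C_circle_0_iff intro!: continuous_intros continuous_on_logistic)
  ultimately have "integral {0..1} (\<lambda>x. max 0 (f x) * w x - exp K / t * w x) \<le> integral {0..1} (\<lambda>x. logistic (h x + t * f x) * f x * w x)"
    by (intro integral_le i2 C_circle_0_integrable)
  also have "integral {0..1} (\<lambda>x. max 0 (f x) * w x - exp K / t * w x) = P - exp K / t * W"
    unfolding P_def W_def using t
    by (subst integral_diff) (auto intro!: C_circle_0_integrable C_circle_0_arith fw C C_circle_0_const)
  also have "exp K / t = P / (W + 1)" using P by (simp add: t_def)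
  also have "P - P / (W + 1) * W = P / (W + 1)" using W by (simp add: field_simps)
  finally have "P / (W + 1) \<le> integral {0..1} (\<lambda>x. logistic (h x + t * f x) * f x * w x)" .
  moreover have "P / (W + 1) > 0" using P W by simp
  ultimately show ?thesis using t by (intro exI[of _ t]) linarith
qed

text \<open>Intermediate value theorem in t: the integral is positive for some t > 0 and, by the
  previous lemma for \<open>- f\<close>, negative for some t < 0. It is applied with f = b and w =
  1/a, where the integral is the increment of F over a period.\<close>

lemma logistic_integral_zero:
  fixes f h w :: "real \<Rightarrow> real"
  assumes C: "f \<in> C_circle 0" "h \<in> C_circle 0" "w \<in> C_circle 0" and w: "\<And>x. w x > 0"
    and f: "f x0 > 0" "f x1 < 0"
  shows "\<exists>t. integral {0..1} (\<lambda>x. logistic (h x + t * f x) * f x * w x) = 0"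
proof -
  define G where "G t = integral {0..1} (\<lambda>x. logistic (h x + t * f x) * f x * w x)" for t
  obtain t where t: "t > 0" "G t > 0" using logistic_integral_pos[OF C w f(1)] unfolding G_def by auto
  have "(\<lambda>x. - f x) \<in> C_circle 0" using C(1) by (auto simp: C_circle_0_iff intro!: continuous_intros)
  from logistic_integral_pos[OF this C(2,3) w, of x1] f(2)
  obtain s where s: "s > 0" "integral {0..1} (\<lambda>x. logistic (h x + s * - f x) * - f x * w x) > 0" by auto
  then have "G (- s) < 0" by (simp add: G_def)
  have cont: "continuous_on UNIV f" "continuous_on UNIV h" "continuous_on UNIV w"
    using C by (auto simp: C_circle_0_iff)
  have "continuous_on UNIV G"
    unfolding G_def[abs_def] cbox_interval[symmetric]
    by (rule integral_continuous_on_param)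
      (auto simp: split_beta intro!: continuous_intros continuous_on_logistic
        continuous_on_compose2[OF cont(1)] continuous_on_compose2[OF cont(2)] continuous_on_compose2[OF cont(3)])
  then have "\<exists>r. - s \<le> r \<and> r \<le> t \<and> G r = 0"
    using \<open>G (- s) < 0\<close> t s by (intro IVT') (auto intro: continuous_on_subset)
  then show ?thesis by (auto simp: G_def)
qed

text \<open>On the compact part of a period where \<open>E\<close> is at least \<open>m + d\<close>,
  \<open>k\<close> has no zero and hence a positive minimum, so \<open>k / \<epsilon>\<close>
  eventually exceeds any bound of \<open>E\<close>. Elsewhere the penalty only helps.\<close>

lemma penalized_upper_bound:
  fixes E k :: "real \<Rightarrow> real"
  assumes E: "E \<in> C_circle 0" and k: "k \<in> C_circle 0" "\<And>x. k x \<ge> 0"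
    and m: "\<And>x. k x = 0 \<Longrightarrow> E x \<le> m" and d: "d > 0"
  shows "\<exists>\<epsilon>0>0. \<forall>\<epsilon>>0. \<epsilon> < \<epsilon>0 \<longrightarrow> (\<forall>x. E x - k x / \<epsilon> \<le> m + d)"
proof -
  define A where "A = {x \<in> {0..1}. m + d \<le> E x}"
  have cont: "continuous_on {0..1} E" "continuous_on {0..1} k"
    using E k by (auto simp: C_circle_0_iff intro: continuous_on_subset)
  have "closed A" unfolding A_def
    using cont(1) by (intro continuous_on_closed_Collect_le) auto
  moreover have "bounded A" by (rule bounded_subset[of "{0..1}"]) (auto simp: A_def)
  ultimately have cA: "compact A" by (simp add: compact_eq_bounded_closed)
  obtain M where M: "M > 0" "\<And>x. \<bar>E x\<bar> \<le> M" using C_circle_0_bounded[OF E] by blast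
  have fr: "E x < m + d \<or> frac x \<in> A" for x
    using frac_lt_1[of x] C_circle_0_frac[OF E, of x] by (auto simp: A_def less_imp_le not_less)
  have "\<exists>k0>0. \<forall>x\<in>A. k0 \<le> k x"
  proof (cases "A = {}")
    case False
    have "continuous_on A k" using cont(2) by (rule continuous_on_subset) (auto simp: A_def)
    from continuous_attains_inf[OF cA False this] obtain y where y: "y \<in> A" "\<forall>x\<in>A. k y \<le> k x" by auto
    have "k y \<noteq> 0" using m[of y] y(1) d by (auto simp: A_def)
    then show ?thesis using y k(2)[of y] by (intro exI[of _ "k y"]) auto
  qed (auto intro: exI[of _ 1])
  then obtain k0 where k0: "k0 > 0" "\<And>x. x \<in> A \<Longrightarrow> k0 \<le> k x" by blast
  have Mm: "M + \<bar>m\<bar> > 0" using M by simp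
  show ?thesis
  proof (intro exI[of _ "k0 / (M + \<bar>m\<bar>)"] conjI allI impI)
    show "k0 / (M + \<bar>m\<bar>) > 0" using k0 Mm by simp
    fix \<epsilon> x assume e: "\<epsilon> > 0" "\<epsilon> < k0 / (M + \<bar>m\<bar>)"
    from fr[of x] show "E x - k x / \<epsilon> \<le> m + d"
    proof
      assume "E x < m + d"
      then show ?thesis using k(2)[of x] e divide_nonneg_pos[of "k x" \<epsilon>] by linarith
    next
      assume "frac x \<in> A"
      then have "k0 \<le> k x" using k0(2)[of "frac x"] C_circle_0_frac[OF k(1), of x] by simp
      have "(M + \<bar>m\<bar>) * \<epsilon> \<le> k0" using e Mm by (simp add: field_simps)
      then have "M + \<bar>m\<bar> \<le> k x / \<epsilon>" using \<open>k0 \<le> k x\<close> e by (simp add: field_simps)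
      then show ?thesis using M(2)[of x] d by linarith
    qed
  qed
qed

text \<open>With \<open>u = exp (- F / \<epsilon>)\<close>, \<open>F' = \<theta> b / a\<close>, one has
  \<open>(\<epsilon> a u'' + b u') / u = - a (\<theta> b / a)' - \<theta> (1 - \<theta>) b\<^sup>2 / (\<epsilon> a)\<close>.  The logistic cutoff \<open>\<theta>\<close> is
  close to 1 at the zeros of \<open>b\<close> with \<open>b' > 0\<close> and close to 0 at those with \<open>b' < 0\<close>; the summand
  \<open>t b\<close> does not affect these values and is used to make \<open>F\<close> periodic.\<close>

lemma principal_eigenvalue_upper_bound:
  fixes a b c :: "real \<Rightarrow> real"
  assumes a: "a \<in> C_circle 2" "\<And>x. a x > 0" and b: "b \<in> C_circle 2" "b x0 > 0" "b x1 < 0"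
    and c: "c \<in> C_circle 0" and m: "\<And>x. b x = 0 \<Longrightarrow> c x - max 0 (nderiv 1 b x) \<le> m" and d: "d > 0"
  shows "\<exists>\<epsilon>0>0. \<forall>\<epsilon>>0. \<epsilon> < \<epsilon>0 \<longrightarrow> principal_eigenvalue a b c \<epsilon> \<le> m + d"
proof -
  \<comment> \<open>With slope \<open>N\<close> the logistic approximates the positive part of b' at
    a zero up to 1/N, which is \<open>d / 2\<close>; the other half of \<open>d\<close> goes to the
    penalisation.\<close>
  define N where "N = 2 / d"
  have N: "N > 0" using d by (simp add: N_def)
  note bC = C_circle_2D(1-3)[OF b(1)] and aC = C_circle_2D(1-3)[OF a(1)]
  note bd = C_circle_2D_real[OF b(1)] and ad = C_circle_2D_real[OF a(1)]
  define b1 b2 a1 where "b1 = nderiv 1 b" and "b2 = nderiv 2 b" and "a1 = nderiv 1 a"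
  note bC = bC[folded b1_def b2_def] and aC = aC[folded a1_def]
  note bd = bd[folded b1_def b2_def] and ad = ad[folded a1_def]
  have an: "a x \<noteq> 0" for x using a(2)[of x] by simp
  have hC: "(\<lambda>x. N * b1 x) \<in> C_circle 0" by (intro C_circle_0_arith C_circle_0_const bC)
  have wC: "(\<lambda>x. 1 / a x) \<in> C_circle 0" by (intro C_circle_0_arith C_circle_0_const aC an)
  obtain t where t: "integral {0..1} (\<lambda>x. logistic (N * b1 x + t * b x) * b x * (1 / a x)) = 0"
    using logistic_integral_zero[OF bC(1) hC wC _ b(2,3)] a(2) by auto
  define th where "th x = logistic (N * b1 x + t * b x)" for x
  define th1 where "th1 x = th x * (1 - th x) * (N * b2 x + t * b1 x)" for x
  have th: "0 < th x" "th x < 1" for x by (simp_all add: th_def logistic_pos logistic_lt_1)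
  have thd: "(th has_real_derivative th1 x) (at x)" for x
    unfolding th_def[abs_def] th1_def
    by (auto intro!: derivative_eq_intros DERIV_chain2[OF logistic_derivative] bd)
  have thC: "th \<in> C_circle 0"
    using hC bC(1) unfolding th_def[abs_def]
    by (auto simp: C_circle_0_iff intro!: continuous_intros continuous_on_logistic)
  have th1C: "th1 \<in> C_circle 0"
    unfolding th1_def[abs_def] by (intro C_circle_0_arith C_circle_0_const thC bC)
  define q where "q x = th x * b x / a x" for x
  define q1 where "q1 x = (th1 x * b x + th x * b1 x - th x * b x * a1 x / a x) / a x" for x
  have qC: "q \<in> C_circle 0" unfolding q_def[abs_def] by (intro C_circle_0_arith thC bC aC an)
  have q1C: "q1 \<in> C_circle 0" unfolding q1_def[abs_def] by (intro C_circle_0_arith thC th1C bC aC an)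
  have qd: "(q has_real_derivative q1 x) (at x)" for x
    unfolding q_def[abs_def] q1_def using an[of x]
    by (auto intro!: derivative_eq_intros thd bd ad simp: field_simps)
  obtain F where F: "\<And>x. (F has_real_derivative q x) (at x)"
    using antiderivative_exists[of q] qC by (auto simp: C_circle_0_iff)
  have "(q has_integral (F 1 - F 0)) {0..1}"
    using F by (intro fundamental_theorem_of_calculus)
      (auto simp: has_real_derivative_iff_has_vector_derivative[symmetric] intro: has_field_derivative_at_within)
  moreover have "integral {0..1} q = 0" using t by (simp add: q_def[abs_def] th_def)
  ultimately have "F 1 - F 0 = 0" using integral_unique by metis
  then have Fp: "F (x + 1) = F x" for x
    using periodic_antiderivative[OF F, of x] qC by (simp add: C_circle_0_iff)
  \<comment> \<open>\<open>k\<close> is b q - a q^2, the coefficient of - 1/\<epsilon>. As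
    \<open>th\<close> stays strictly between 0 and 1, it vanishes only at zeros of \<open>b\<close>,
    where \<open>m\<close> controls \<open>E\<close>.\<close>
  define k where "k x = th x * (1 - th x) * ((b x)\<^sup>2 / a x)" for x
  define E where "E x = c x - a x * q1 x" for x
  have kC: "k \<in> C_circle 0" unfolding k_def[abs_def] power2_eq_square
    by (intro C_circle_0_arith C_circle_0_const thC bC aC an)
  have EC: "E \<in> C_circle 0" unfolding E_def[abs_def]
    by (intro C_circle_0_arith c aC q1C)
  have k0: "k x \<ge> 0" for x using th[of x] a(2)[of x] by (simp add: k_def less_imp_le)
  have Em: "E x \<le> m + d / 2" if "k x = 0" for x
  proof -
    have b0: "b x = 0" using that th[of x] an[of x] by (simp add: k_def)
    then have "a x * q1 x = b1 x * logistic (0 + N * b1 x)" using an[of x] by (simp add: q1_def th_def)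
    moreover have "N * max 0 (b1 x) - 1 \<le> N * (b1 x * logistic (0 + N * b1 x))"
      using logistic_mult_ge[of 0 0 "N * b1 x"] N by (simp add: max_def mult_le_0_iff zero_le_mult_iff split: if_splits)
    then have "N * (max 0 (b1 x) - d / 2) \<le> N * (b1 x * logistic (0 + N * b1 x))"
      using d by (simp add: N_def right_diff_distrib)
    then have "max 0 (b1 x) - d / 2 \<le> b1 x * logistic (0 + N * b1 x)"
      using N by (rule mult_left_le_imp_le)
    ultimately show ?thesis using m[OF b0] by (simp add: E_def b1_def)
  qed
  have d2: "d / 2 > 0" using d by simp
  from penalized_upper_bound[OF EC kC k0 Em d2] obtain \<epsilon>0 where
    e0: "\<epsilon>0 > 0" "\<And>\<epsilon> x. \<epsilon> > 0 \<Longrightarrow> \<epsilon> < \<epsilon>0 \<Longrightarrow> E x - k x / \<epsilon> \<le> m + d / 2 + d / 2" by blast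
  show ?thesis
  proof (intro exI[of _ \<epsilon>0] conjI allI impI)
    fix \<epsilon> :: real assume e: "\<epsilon> > 0" "\<epsilon> < \<epsilon>0"
    define u where "u x = exp (- F x / \<epsilon>)" for x
    define u1 where "u1 x = - q x / \<epsilon> * u x" for x
    define u2 where "u2 x = ((q x)\<^sup>2 / \<epsilon>\<^sup>2 - q1 x / \<epsilon>) * u x" for x
    have ud: "(u has_real_derivative u1 x) (at x)" for x
      unfolding u_def[abs_def] u1_def using e by (auto intro!: derivative_eq_intros F)
    have u1d: "(u1 has_real_derivative u2 x) (at x)" for x
      unfolding u1_def[abs_def] u2_def using e
      by (auto intro!: derivative_eq_intros qd ud simp: u1_def field_simps power2_eq_square)
    have up: "u (x + 1) = u x" for x by (simp add: u_def Fp)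
    have cu: "continuous_on UNIV u" using ud by (meson continuous_at_imp_continuous_on DERIV_isCont)
    have "continuous_on UNIV u2" unfolding u2_def[abs_def]
      using qC q1C cu e by (auto simp: C_circle_0_iff intro!: continuous_intros)
    then have D: "u \<in> C_circle 2" "nderiv 1 u = u1" "nderiv 2 u = u2"
      using C_circle_2I[of u u1 u2] up ud u1d by (auto simp: has_real_derivative_iff_has_vector_derivative)
    have u0: "u x > 0" for x by (simp add: u_def)
    show "principal_eigenvalue a b c \<epsilon> \<le> m + d"
    proof (rule principal_eigenvalue_le_supersolution[OF aC(1) a(2) bC(1) c e(1) D(1) u0])
      fix x
      have "\<epsilon> * a x * nderiv 2 u x + b x * nderiv 1 u x + c x * u x
          = (E x - (b x * q x - a x * (q x)\<^sup>2) / \<epsilon>) * u x"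
        using e unfolding D u2_def u1_def E_def by (simp add: field_simps power2_eq_square)
      also have "b x * q x - a x * (q x)\<^sup>2 = k x"
        using an[of x] by (simp add: q_def k_def field_simps power2_eq_square)
      also have "(E x - k x / \<epsilon>) * u x \<le> (m + d) * u x"
        using e0(2)[OF e, of x] u0[of x] by (intro mult_right_mono) auto
      finally show "\<epsilon> * a x * nderiv 2 u x + b x * nderiv 1 u x + c x * u x \<le> (m + d) * u x" .
    qed
  qed (rule e0)
qed

section \<open>Lower bound: densities concentrated at a zero of the drift\<close>

text \<open>\<open>F\<close> is a cut-off Gaussian, and the integral to be bounded is the energy of a harmonic oscillator,
  with ground state energy \<open>\<bar>\<beta>\<bar> / 2 + \<beta> / 2\<close>.  That \<open>D1\<close> has integral 0 controls the cutoff error \<open>Y\<close> by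
  the normalisation \<open>X\<close>, uniformly in \<open>\<gamma>\<close>.\<close>

lemma trial_profile:
  fixes a0 \<beta> R :: real
  assumes a0: "a0 > 0" and R: "R > 0"
  obtains F F1 where "\<And>y. (F has_real_derivative F1 y) (at y)" "continuous_on UNIV F1"
    "F R = 0" "F (- R) = 0" "integral {-R..R} (\<lambda>y. (F y)\<^sup>2) = 1"
    "integral {-R..R} (\<lambda>y. (2 * a0 * F1 y - \<beta> * y * F y)\<^sup>2 / (4 * a0)) \<le> max 0 \<beta> + 4 * a0 / R\<^sup>2"
proof -
  \<comment> \<open>Expanding the square and integrating the cross term by parts leaves a0 F'^2 +
    (\<beta> y F)^2 / (4 a0) + \<beta> F^2 / 2. The ground state of this oscillator is exp(-
    \<gamma> y^2 / 2); \<open>W\<close> is its square and \<open>ch\<close> the cutoff.\<close>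
  define \<gamma> where "\<gamma> = \<bar>\<beta>\<bar> / (2 * a0)"
  define r where "r = 1 / R\<^sup>2"
  define W where "W y = exp (- \<gamma> * y\<^sup>2)" for y
  define ch where "ch y = 1 - r * y\<^sup>2" for y
  have g0: "\<gamma> \<ge> 0" using a0 by (simp add: \<gamma>_def)
  have r0: "r > 0" using R by (simp add: r_def)
  have chR: "ch R = 0" "ch (- R) = 0" using R by (simp_all add: ch_def r_def)
  have ch0: "ch y \<ge> 0" if "y \<in> {-R..R}" for y
  proof -
    have "y\<^sup>2 \<le> R\<^sup>2" using that by (auto simp: abs_le_square_iff[symmetric])
    then show ?thesis using R by (simp add: ch_def r_def)
  qed
  have Wd: "(W has_real_derivative (- 2 * \<gamma> * y * W y)) (at y)" for y
    unfolding W_def[abs_def] by (auto intro!: derivative_eq_intros simp: W_def)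
  have chd: "(ch has_real_derivative (- 2 * r * y)) (at y)" for y
    unfolding ch_def[abs_def] by (auto intro!: derivative_eq_intros)
  have W0: "W y > 0" for y by (simp add: W_def)
  have contW: "continuous_on A W" for A unfolding W_def[abs_def] by (intro continuous_intros)
  have contch: "continuous_on A ch" for A unfolding ch_def[abs_def] by (intro continuous_intros)
  note ci = continuous_intros contW contch
  \<comment> \<open>\<open>D1\<close> and \<open>D2\<close> are derivatives of functions vanishing
    at \<open>R\<close> and \<open>- R\<close>; adding multiples of them changes integrands but not
    integrals.\<close>
  define D1 where "D1 y = W y * (1 - 3 * r * y\<^sup>2 - 2 * \<gamma> * y\<^sup>2 * ch y)" for y
  define D2 where "D2 y = W y * ((ch y)\<^sup>2 - 4 * r * y\<^sup>2 * ch y - 2 * \<gamma> * y\<^sup>2 * (ch y)\<^sup>2)" for y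
  have "((\<lambda>y. W y * y * ch y) has_real_derivative D1 y) (at y)" for y
    unfolding D1_def
    by (auto intro!: derivative_eq_intros Wd chd simp: ch_def algebra_simps power2_eq_square)
  then have D1: "(D1 has_integral 0) {-R..R}"
    using fundamental_theorem_of_calculus[of "-R" R "\<lambda>y. W y * y * ch y" D1] R
    by (simp add: chR has_real_derivative_iff_has_vector_derivative has_vector_derivative_at_within)
  have "((\<lambda>y. W y * y * (ch y)\<^sup>2) has_real_derivative D2 y) (at y)" for y
    unfolding D2_def
    by (auto intro!: derivative_eq_intros Wd chd simp: algebra_simps power2_eq_square)
  then have D2: "(D2 has_integral 0) {-R..R}"
    using fundamental_theorem_of_calculus[of "-R" R "\<lambda>y. W y * y * (ch y)\<^sup>2" D2] R
    by (simp add: chR has_real_derivative_iff_has_vector_derivative has_vector_derivative_at_within)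
  define X where "X = integral {-R..R} (\<lambda>y. W y * (ch y)\<^sup>2)"
  have hX: "((\<lambda>y. W y * (ch y)\<^sup>2) has_integral X) {-R..R}"
    unfolding X_def by (intro integrable_integral integrable_continuous_real ci)
  define Y where "Y = integral {-R..R} (\<lambda>y. W y * (r * y\<^sup>2))"
  have hY: "((\<lambda>y. W y * (r * y\<^sup>2)) has_integral Y) {-R..R}"
    unfolding Y_def by (intro integrable_integral integrable_continuous_real ci)
  have X0: "X > 0"
  proof -
    have "X \<ge> 0" unfolding X_def using W0
      by (intro integral_nonneg integrable_continuous_real ci) (simp add: less_imp_le)
    moreover have "X \<noteq> 0"
    proof
      assume "X = 0"
      then have "\<forall>y\<in>{-R..R}. W y * (ch y)\<^sup>2 = 0"
        unfolding X_def using R W0 by (subst (asm) integral_eq_0_iff) (auto intro!: ci simp: less_imp_le)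
      then have "W 0 * (ch 0)\<^sup>2 = 0" using R by (metis atLeastAtMost_iff less_imp_le neg_le_0_iff_le)
      then show False by (simp add: W_def ch_def)
    qed
    ultimately show ?thesis by simp
  qed
  \<comment> \<open>W ch^2 - W r y^2 - D1 equals W (r^2 y^4 + 2 \<gamma> y^2 ch), which is
    nonnegative on the interval for every \<gamma> >= 0.\<close>
  have YX: "Y \<le> X"
  proof -
    have "Y + 0 \<le> X"
    proof (rule has_integral_le[OF has_integral_add[OF hY D1] hX])
      fix y assume y: "y \<in> {-R..R}"
      have "0 \<le> W y * (r\<^sup>2 * (y\<^sup>2)\<^sup>2 + 2 * \<gamma> * y\<^sup>2 * ch y)"
        using W0[of y] g0 ch0[OF y] by (intro mult_nonneg_nonneg add_nonneg_nonneg) auto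
      also have "\<dots> = W y * (ch y)\<^sup>2 - (W y * (r * y\<^sup>2) + D1 y)"
        by (simp add: D1_def ch_def algebra_simps power2_eq_square)
      finally show "W y * (r * y\<^sup>2) + D1 y \<le> W y * (ch y)\<^sup>2" by simp
    qed
    then show ?thesis by simp
  qed
  define n where "n = 1 / sqrt X"
  have n2: "n\<^sup>2 = 1 / X" using X0 by (simp add: n_def power_divide)
  define E where "E y = exp (- \<gamma> * y\<^sup>2 / 2)" for y
  have E2: "(E y)\<^sup>2 = W y" for y by (simp add: E_def W_def power2_eq_square mult_exp_exp)
  have Ed: "(E has_real_derivative (- \<gamma> * y * E y)) (at y)" for y
    unfolding E_def[abs_def] by (auto intro!: derivative_eq_intros simp: E_def)
  define F where "F y = n * E y * ch y" for y
  define F1 where "F1 y = n * E y * (- \<gamma> * y * ch y - 2 * r * y)" for y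
  have Fd: "(F has_real_derivative F1 y) (at y)" for y
    unfolding F_def[abs_def] F1_def by (auto intro!: derivative_eq_intros Ed chd simp: algebra_simps)
  have F1c: "continuous_on UNIV F1" unfolding F1_def[abs_def] E_def by (intro ci) simp
  have F2: "(F y)\<^sup>2 = 1 / X * (W y * (ch y)\<^sup>2)" for y
    by (simp add: F_def power_mult_distrib n2 E2)
  define \<beta>p where "\<beta>p = max 0 \<beta>"
  \<comment> \<open>For \<beta> < 0 the drift term cancels the derivative of the Gaussian and only
    the derivative of the cutoff remains. For \<beta> >= 0 the two add up, and subtracting a
    multiple of \<open>D2\<close> exposes the ground state energy \<beta>.\<close>
  have cost: "(2 * a0 * F1 y - \<beta> * y * F y)\<^sup>2 / (4 * a0)
      = 4 * a0 * r / X * (W y * (r * y\<^sup>2)) + \<beta>p / X * (W y * (ch y)\<^sup>2) - \<beta>p / X * D2 y" for y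
  proof (cases "\<beta> \<ge> 0")
    case True
    then have b: "\<beta> = 2 * a0 * \<gamma>" "\<beta>p = 2 * a0 * \<gamma>" using a0 by (simp_all add: \<gamma>_def \<beta>p_def)
    have "2 * a0 * F1 y - \<beta> * y * F y = - (2 * a0 * n * E y * (2 * \<gamma> * y * ch y + 2 * r * y))"
      by (simp add: F1_def F_def b algebra_simps)
    then have "(2 * a0 * F1 y - \<beta> * y * F y)\<^sup>2 = 4 * a0\<^sup>2 * (1 / X) * W y * (2 * \<gamma> * y * ch y + 2 * r * y)\<^sup>2"
      by (simp only: power2_minus power_mult_distrib n2 E2) simp
    then show ?thesis
      using a0 X0 unfolding b D2_def by (simp add: field_simps power2_eq_square)
  next
    case False
    then have b: "\<beta> = - 2 * a0 * \<gamma>" "\<beta>p = 0" using a0 by (simp_all add: \<gamma>_def \<beta>p_def)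
    have "2 * a0 * F1 y - \<beta> * y * F y = - (2 * a0 * n * E y * (2 * r * y))"
      by (simp add: F1_def F_def b algebra_simps)
    then have "(2 * a0 * F1 y - \<beta> * y * F y)\<^sup>2 = 4 * a0\<^sup>2 * (1 / X) * W y * (2 * r * y)\<^sup>2"
      by (simp only: power2_minus power_mult_distrib n2 E2) simp
    then show ?thesis
      using a0 X0 unfolding b by (simp add: field_simps power2_eq_square)
  qed
  have "((\<lambda>y. (2 * a0 * F1 y - \<beta> * y * F y)\<^sup>2 / (4 * a0)) has_integral
      (4 * a0 * r / X * Y + \<beta>p / X * X - \<beta>p / X * 0)) {-R..R}"
    unfolding cost by (intro has_integral_diff has_integral_add has_integral_mult_right hX hY D2)
  then have "integral {-R..R} (\<lambda>y. (2 * a0 * F1 y - \<beta> * y * F y)\<^sup>2 / (4 * a0)) = 4 * a0 * r * (Y / X) + \<beta>p"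
    using X0 by (subst integral_unique) simp_all
  also have "4 * a0 * r * (Y / X) \<le> 4 * a0 * r * 1"
    using YX X0 a0 r0 by (intro mult_left_mono) auto
  finally have "integral {-R..R} (\<lambda>y. (2 * a0 * F1 y - \<beta> * y * F y)\<^sup>2 / (4 * a0)) \<le> max 0 \<beta> + 4 * a0 / R\<^sup>2"
    by (simp add: \<beta>p_def r_def)
  moreover have "integral {-R..R} (\<lambda>y. (F y)\<^sup>2) = 1"
    unfolding F2 using integral_unique[OF has_integral_mult_right[OF hX, of "1 / X"]] X0 by simp
  ultimately show ?thesis
    using that[OF Fd F1c] by (simp add: F_def chR)
qed

text \<open>Integration by parts, followed by completing the square in \<open>u' / u\<close>.\<close>

lemma rescaled_energy_bound:
  fixes a b u F F1 :: "real \<Rightarrow> real"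
  assumes a: "a \<in> C_circle 2" "\<And>x. a x > 0" and b: "b \<in> C_circle 0" and u: "u \<in> C_circle 2" "\<And>x. u x > 0"
    and F: "\<And>y. (F has_real_derivative F1 y) (at y)" "continuous_on UNIV F1" "F R = 0" "F (- R) = 0"
    and s: "s > 0" and R: "R > 0"
  shows "- integral {-R..R} (\<lambda>y. (s\<^sup>2 * a (z + s * y) * nderiv 2 u (z + s * y) + b (z + s * y) * nderiv 1 u (z + s * y))
        / u (z + s * y) * (F y)\<^sup>2)
    \<le> integral {-R..R} (\<lambda>y. (s * nderiv 1 a (z + s * y) * F y + 2 * a (z + s * y) * F1 y - b (z + s * y) / s * F y)\<^sup>2
        / (4 * a (z + s * y)))"
proof -
  define a1 u1 u2 where "a1 = nderiv 1 a" and "u1 = nderiv 1 u" and "u2 = nderiv 2 u"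
  note aC = C_circle_2D(1,2)[OF a(1), folded a1_def] and ad = C_circle_2D_real(1)[OF a(1), folded a1_def]
  note uC = C_circle_2D(1-3)[OF u(1), folded u1_def u2_def] and ud = C_circle_2D_real[OF u(1), folded u1_def u2_def]
  have un: "u x \<noteq> 0" and an: "a x \<noteq> 0" for x using u(2)[of x] a(2)[of x] by auto
  define x where "x y = z + s * y" for y
  have xd: "(x has_real_derivative s) (at y)" for y unfolding x_def[abs_def] by (auto intro!: derivative_eq_intros)
  have cx: "continuous_on A x" for A unfolding x_def[abs_def] by (intro continuous_intros)
  have cc: "continuous_on A (\<lambda>y. f (x y))" if "f \<in> C_circle 0" for f :: "real \<Rightarrow> real" and A
    using that cx by (auto simp: C_circle_0_iff intro!: continuous_on_compose2[of UNIV f])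
  have cF: "continuous_on A F" for A using F(1) by (meson continuous_at_imp_continuous_on DERIV_isCont)
  have cF1: "continuous_on A F1" for A using F(2) by (rule continuous_on_subset) simp
  note ci = continuous_intros cF cF1 cc[OF aC(1)] cc[OF aC(2)] cc[OF b] cc[OF uC(1)] cc[OF uC(2)] cc[OF uC(3)]
  define P where "P y = u1 (x y) / u (x y)" for y
  \<comment> \<open>The boundary term of the integration by parts: it vanishes at both ends because
    \<open>F\<close> does, so its derivative \<open>Q1\<close> has integral 0.\<close>
  define Q where "Q y = s * a (x y) * P y * (F y)\<^sup>2" for y
  define Q1 where "Q1 y = s\<^sup>2 * a1 (x y) * P y * (F y)\<^sup>2 + s\<^sup>2 * a (x y) * (u2 (x y) / u (x y) - (P y)\<^sup>2) * (F y)\<^sup>2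
    + 2 * s * a (x y) * P y * F y * F1 y" for y
  have cP: "continuous_on A P" for A unfolding P_def[abs_def] using un by (intro ci) auto
  have Pd: "(P has_real_derivative s * (u2 (x y) / u (x y) - (P y)\<^sup>2)) (at y)" for y
    unfolding P_def[abs_def] using un[of "x y"]
    by (auto intro!: derivative_eq_intros DERIV_chain2[OF ud(1) xd] DERIV_chain2[OF ud(2) xd]
        simp: field_simps power2_eq_square)
  have Qd: "(Q has_real_derivative Q1 y) (at y)" for y
    unfolding Q_def[abs_def] Q1_def
    by (auto intro!: derivative_eq_intros Pd F(1) DERIV_chain2[OF ad xd] simp: algebra_simps power2_eq_square)
  have hQ: "(Q1 has_integral 0) {-R..R}"
    using fundamental_theorem_of_calculus[of "-R" R Q Q1] R Qd
    by (simp add: Q_def F(3,4) has_real_derivative_iff_has_vector_derivative has_vector_derivative_at_within)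
  define g where "g y = (s\<^sup>2 * a (x y) * u2 (x y) + b (x y) * u1 (x y)) / u (x y) * (F y)\<^sup>2" for y
  define H where "H y = s * a1 (x y) * F y + 2 * a (x y) * F1 y - b (x y) / s * F y" for y
  have cg: "continuous_on {-R..R} g" unfolding g_def[abs_def] using un by (intro ci) auto
  have cH: "continuous_on {-R..R} (\<lambda>y. (H y)\<^sup>2 / (4 * a (x y)))"
    unfolding H_def[abs_def] using an s by (intro ci) auto
  have le: "- g y - - Q1 y \<le> (H y)\<^sup>2 / (4 * a (x y))" for y
  proof -
    define A where "A = a (x y)"
    have A: "A > 0" using a(2) by (simp add: A_def)
    have "g y = (s\<^sup>2 * A * (u2 (x y) / u (x y)) + b (x y) * P y) * (F y)\<^sup>2"
      by (simp add: g_def P_def A_def add_divide_distrib)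
    moreover have "s * P y * F y * H y = s\<^sup>2 * a1 (x y) * P y * (F y)\<^sup>2 + 2 * s * A * P y * F y * F1 y - b (x y) * P y * (F y)\<^sup>2"
      using s by (simp add: H_def A_def field_simps power2_eq_square)
    ultimately have "Q1 y - g y = s * P y * F y * H y - A * (s * P y * F y)\<^sup>2"
      by (simp add: Q1_def A_def algebra_simps power2_eq_square)
    also have "\<dots> \<le> (H y)\<^sup>2 / (4 * A)"
    proof -
      have "0 \<le> (H y - 2 * A * (s * P y * F y))\<^sup>2 / (4 * A)" using A by simp
      also have "\<dots> = (H y)\<^sup>2 / (4 * A) - (s * P y * F y * H y - A * (s * P y * F y)\<^sup>2)"
        using A by (simp add: field_simps power2_eq_square)
      finally show ?thesis by simp
    qed
    finally show ?thesis by (simp add: A_def)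
  qed
  have "- integral {-R..R} g - - 0 \<le> integral {-R..R} (\<lambda>y. (H y)\<^sup>2 / (4 * a (x y)))"
    by (rule has_integral_le[OF has_integral_diff[OF has_integral_neg has_integral_neg[OF hQ]] _ le])
      (intro integrable_integral integrable_continuous_real cg cH)+
  then show ?thesis by (simp add: g_def[abs_def] H_def[abs_def] x_def u1_def u2_def a1_def)
qed

text \<open>The density lives on the line, so its support may cross an integer; folding into the
  circle comes later. The last clause is the bound on \<open>I_fun\<close> written before the
  supremum over u: in this form it is linear in \<open>\<rho>\<close> and passes to mixtures. One
  \<open>d\<close> measures both the radius of the support and the excess energy.\<close>

definition recovery_density ::
  "(real \<Rightarrow> real) \<Rightarrow> (real \<Rightarrow> real) \<Rightarrow> real \<Rightarrow> real \<Rightarrow> real \<Rightarrow> (real \<Rightarrow> real) \<Rightarrow> bool" where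
  "recovery_density a b z \<epsilon> d \<rho> \<longleftrightarrow>
     \<rho> \<in> borel_measurable borel \<and> (\<forall>x. \<rho> x \<ge> 0) \<and> integrable lborel \<rho> \<and> (LINT x|lborel. \<rho> x) = 1 \<and>
     (\<forall>x. \<rho> x \<noteq> 0 \<longrightarrow> \<bar>x - z\<bar> \<le> d) \<and>
     (\<forall>u \<in> C_circle 2. (\<forall>x. u x > 0) \<longrightarrow>
        - (LINT x|lborel. (\<epsilon> * a x * nderiv 2 u x + b x * nderiv 1 u x) / u x * \<rho> x) \<le> max 0 (nderiv 1 b z) + d)"

lemma rescaled_density_integral:
  fixes g F :: "real \<Rightarrow> real"
  assumes g: "continuous_on UNIV g" and F: "continuous_on UNIV F" and s: "s > 0"
  shows "(LINT x|lborel. g x * (indicator {-R..R} ((x - z) / s) * (F ((x - z) / s))\<^sup>2 / s))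
    = integral {-R..R} (\<lambda>y. g (z + s * y) * (F y)\<^sup>2)"
proof -
  have "(LINT x|lborel. g x * (indicator {-R..R} ((x - z) / s) * (F ((x - z) / s))\<^sup>2 / s))
    = s * (LINT y|lborel. g (z + s * y) * (indicator {-R..R} y * (F y)\<^sup>2 / s))"
    using lborel_integral_real_affine[of s "\<lambda>x. g x * (indicator {-R..R} ((x - z) / s) * (F ((x - z) / s))\<^sup>2 / s)" z] s
    by simp
  also have "\<dots> = (LINT y|lborel. s * (g (z + s * y) * (indicator {-R..R} y * (F y)\<^sup>2 / s)))" by simp
  also have "\<dots> = (LINT y:{-R..R}|lborel. g (z + s * y) * (F y)\<^sup>2)"
    unfolding set_lebesgue_integral_def using s by (intro Bochner_Integration.integral_cong) auto
  also have "\<dots> = integral {-R..R} (\<lambda>y. g (z + s * y) * (F y)\<^sup>2)"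
    using g F by (intro set_borel_integral_eq_integral borel_integrable_atLeastAtMost')
      (auto intro!: continuous_intros continuous_on_compose2[OF g] intro: continuous_on_subset)
  finally show ?thesis .
qed

text \<open>Since \<open>b z = 0\<close>, the quotient b(z + s y)/s tends to b'(z) y, while the term
  with the derivative of \<open>a\<close> carries a factor s. The Lipschitz bound on
  \<open>b\<close> also bounds the quotient on the interval uniformly in s, which supplies a
  constant majorant.\<close>

lemma rescaled_energy_tendsto:
  fixes a b F F1 :: "real \<Rightarrow> real" and s :: "nat \<Rightarrow> real"
  assumes a: "a \<in> C_circle 2" "\<And>x. a x > 0" and b: "b \<in> C_circle 2" "b z = 0"
    and F: "continuous_on UNIV F" "continuous_on UNIV F1"
    and s: "\<And>k. s k > 0" "s \<longlonglongrightarrow> 0" and R: "R > 0"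
  shows "(\<lambda>k. integral {-R..R} (\<lambda>y. (s k * nderiv 1 a (z + s k * y) * F y + 2 * a (z + s k * y) * F1 y
          - b (z + s k * y) / s k * F y)\<^sup>2 / (4 * a (z + s k * y))))
    \<longlonglongrightarrow> integral {-R..R} (\<lambda>y. (2 * a z * F1 y - nderiv 1 b z * y * F y)\<^sup>2 / (4 * a z))"
proof -
  define a1 b1 where "a1 = nderiv 1 a" and "b1 = nderiv 1 b"
  note aC = C_circle_2D(1,2)[OF a(1), folded a1_def]
  note bC = C_circle_2D(1,2)[OF b(1), folded b1_def] and bd = C_circle_2D_real(1)[OF b(1), folded b1_def]
  have an: "a x \<noteq> 0" for x using a(2)[of x] by simp
  define H where "H k y = s k * a1 (z + s k * y) * F y + 2 * a (z + s k * y) * F1 y - b (z + s k * y) / s k * F y" for k y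
  have cc: "continuous_on A (\<lambda>y. f (z + c * y))" if "f \<in> C_circle 0" for f :: "real \<Rightarrow> real" and A c
    using that by (auto simp: C_circle_0_iff intro!: continuous_on_compose2[of UNIV f] continuous_intros)
  have cF: "continuous_on A F" "continuous_on A F1" for A using F by (auto intro: continuous_on_subset)
  have sn: "s k \<noteq> 0" for k using s(1)[of k] by simp
  have "Bseq s" using s(2) by (intro convergent_imp_Bseq) (auto simp: convergent_def)
  then obtain Sb where Sb: "Sb > 0" "\<And>k. \<bar>s k\<bar> \<le> Sb" by (auto simp: Bseq_def)
  obtain A1 where A1: "A1 > 0" "\<And>x. \<bar>a1 x\<bar> \<le> A1" using C_circle_0_bounded[OF aC(2)] by blast
  obtain A0 where A0: "A0 > 0" "\<And>x. \<bar>a x\<bar> \<le> A0" using C_circle_0_bounded[OF aC(1)] by blast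
  obtain B1 where B1: "B1 > 0" "\<And>x. \<bar>b1 x\<bar> \<le> B1" using C_circle_0_bounded[OF bC(2)] by blast
  obtain xm where xm: "\<And>x. a xm \<le> a x" using C_circle_0_attains_inf[OF aC(1)] by blast
  have bnd: "\<exists>M>0. \<forall>y\<in>{-R..R}. \<bar>f y\<bar> \<le> M" if "continuous_on UNIV f" for f :: "real \<Rightarrow> real"
  proof -
    have "compact (f ` {-R..R})"
      using that by (intro compact_continuous_image) (auto intro: continuous_on_subset)
    from compact_imp_bounded[OF this] obtain M where "M > 0" "\<forall>y\<in>f ` {-R..R}. norm y \<le> M"
      unfolding bounded_pos by blast
    then show ?thesis by auto
  qed
  obtain M where M: "M > 0" "\<And>y. y \<in> {-R..R} \<Longrightarrow> \<bar>F y\<bar> \<le> M" using bnd[OF F(1)] by blast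
  obtain M1 where M1: "M1 > 0" "\<And>y. y \<in> {-R..R} \<Longrightarrow> \<bar>F1 y\<bar> \<le> M1" using bnd[OF F(2)] by blast
  define Hm where "Hm = Sb * A1 * M + 2 * A0 * M1 + B1 * R * M"
  have bs: "\<bar>b (z + s k * y) / s k\<bar> \<le> B1 * R" if "y \<in> {-R..R}" for k y
  proof -
    have "norm (b (z + s k * y) - b z) \<le> B1 * norm (z + s k * y - z)"
      by (rule field_differentiable_bound[of UNIV _ b1]) (use bd B1 in auto)
    then have "\<bar>b (z + s k * y)\<bar> \<le> B1 * (s k * \<bar>y\<bar>)" using s(1)[of k] b(2) by (simp add: abs_mult)
    also have "\<dots> \<le> B1 * (s k * R)" using that B1 s(1)[of k] by (intro mult_left_mono) auto
    finally show ?thesis using s(1)[of k] by (simp add: field_simps)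
  qed
  have Hb: "\<bar>H k y\<bar> \<le> Hm" if y: "y \<in> {-R..R}" for k y
  proof -
    have "\<bar>s k * a1 (z + s k * y) * F y\<bar> \<le> Sb * A1 * M"
      unfolding abs_mult using Sb A1 M(1) M(2)[OF y] by (intro mult_mono) auto
    moreover have "\<bar>2 * a (z + s k * y) * F1 y\<bar> \<le> 2 * A0 * M1"
      unfolding abs_mult using A0 M1(1) M1(2)[OF y] by (intro mult_mono) auto
    moreover have "\<bar>b (z + s k * y) / s k * F y\<bar> \<le> B1 * R * M"
      unfolding abs_mult using bs[OF y, of k] B1 R M(1) M(2)[OF y] by (intro mult_mono) auto
    ultimately show ?thesis unfolding H_def Hm_def by linarith
  qed
  have "(\<lambda>k. integral {-R..R} (\<lambda>y. (H k y)\<^sup>2 / (4 * a (z + s k * y))))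
     \<longlonglongrightarrow> integral {-R..R} (\<lambda>y. (2 * a z * F1 y - b1 z * y * F y)\<^sup>2 / (4 * a z))"
  proof (rule dominated_convergence(2)[where h = "\<lambda>_. Hm\<^sup>2 / (4 * a xm)"])
    show "(\<lambda>y. (H k y)\<^sup>2 / (4 * a (z + s k * y))) integrable_on {-R..R}" for k
      unfolding H_def using an sn
      by (intro integrable_continuous_real continuous_intros cF cc aC bC) auto
    show "(\<lambda>_. Hm\<^sup>2 / (4 * a xm)) integrable_on {-R..R}"
      by (intro integrable_continuous_real continuous_intros)
    show "norm ((H k y)\<^sup>2 / (4 * a (z + s k * y))) \<le> Hm\<^sup>2 / (4 * a xm)" if "y \<in> {-R..R}" for k y
    proof -
      have "(H k y)\<^sup>2 \<le> Hm\<^sup>2" using Hb[OF that, of k] by (metis abs_ge_zero power2_abs power_mono)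
      then have "(H k y)\<^sup>2 / (4 * a (z + s k * y)) \<le> Hm\<^sup>2 / (4 * a xm)"
        using a(2) xm by (intro frac_le) auto
      then show ?thesis using a(2)[of "z + s k * y"] by simp
    qed
    fix y assume y: "y \<in> {-R..R}"
    have xk: "(\<lambda>k. z + s k * y) \<longlonglongrightarrow> z + 0 * y" by (intro tendsto_intros s)
    have lim: "(\<lambda>k. f (z + s k * y)) \<longlonglongrightarrow> f z" if "f \<in> C_circle 0" for f :: "real \<Rightarrow> real"
      using that xk by (intro isCont_tendsto_compose[of z f])
        (auto simp: C_circle_0_iff continuous_on_eq_continuous_at)
    have "((\<lambda>t. b (z + t * y)) has_real_derivative b1 z * y) (at 0)"
      by (rule DERIV_chain2[of b "b1 z" "\<lambda>t. z + t * y"]) (use bd in \<open>auto intro!: derivative_eq_intros\<close>)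
    then have "((\<lambda>h. (b (z + h * y) - b z) / h) \<longlongrightarrow> b1 z * y) (at 0)"
      by (simp add: DERIV_def)
    moreover have "filterlim s (at 0) sequentially"
      using s sn by (simp add: filterlim_at)
    ultimately have lb: "(\<lambda>k. b (z + s k * y) / s k) \<longlonglongrightarrow> b1 z * y"
      using filterlim_compose[of "\<lambda>h. (b (z + h * y) - b z) / h" _ "at 0" s] b(2) by simp
    have "(\<lambda>k. (H k y)\<^sup>2 / (4 * a (z + s k * y)))
      \<longlonglongrightarrow> (0 * a1 z * F y + 2 * a z * F1 y - b1 z * y * F y)\<^sup>2 / (4 * a z)"
      unfolding H_def using an by (intro tendsto_intros s lim aC lb) auto
    then show "(\<lambda>k. (H k y)\<^sup>2 / (4 * a (z + s k * y))) \<longlonglongrightarrow> (2 * a z * F1 y - b1 z * y * F y)\<^sup>2 / (4 * a z)"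
      by simp
  qed
  then show ?thesis by (simp add: H_def a1_def b1_def)
qed

text \<open>At distance of order sqrt \<epsilon> from a nondegenerate zero, the diffusion and the
  linearised drift have the same size. The profile on [-R, R] is fixed first; only its scale then
  varies with \<open>k\<close>.\<close>

lemma eventually_recovery_density:
  fixes a b :: "real \<Rightarrow> real" and e :: "nat \<Rightarrow> real"
  assumes a: "a \<in> C_circle 2" "\<And>x. a x > 0" and b: "b \<in> C_circle 2" "b z = 0"
    and e: "\<And>k. e k > 0" "e \<longlonglongrightarrow> 0" and d: "d > 0"
  shows "\<forall>\<^sub>F k in sequentially. \<exists>\<rho>. recovery_density a b z (e k) d \<rho>"
proof -
  \<comment> \<open>Makes the cutoff error equal to \<open>d / 2\<close>; the remaining half of
    \<open>d\<close> is the tolerance for the convergence of the rescaled energy.\<close>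
  define R where "R = sqrt (8 * a z / d)"
  have R: "R > 0" using a(2) d by (simp add: R_def)
  have R2: "4 * a z / R\<^sup>2 = d / 2" using a(2)[of z] d by (simp add: R_def less_imp_le field_simps)
  obtain F F1 where F: "\<And>y. (F has_real_derivative F1 y) (at y)" "continuous_on UNIV F1" "F R = 0" "F (- R) = 0"
    and F2: "integral {-R..R} (\<lambda>y. (F y)\<^sup>2) = 1"
    and cost: "integral {-R..R} (\<lambda>y. (2 * a z * F1 y - nderiv 1 b z * y * F y)\<^sup>2 / (4 * a z))
      \<le> max 0 (nderiv 1 b z) + 4 * a z / R\<^sup>2"
    using trial_profile[OF a(2) R, of z "nderiv 1 b z"] by blast
  have cF: "continuous_on UNIV F" using F(1) by (meson continuous_at_imp_continuous_on DERIV_isCont)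
  define s where "s k = sqrt (e k)" for k
  have s: "s k > 0" "(s k)\<^sup>2 = e k" for k using e(1)[of k] by (simp_all add: s_def)
  have s0: "s \<longlonglongrightarrow> 0" using tendsto_real_sqrt[OF e(2)] by (simp add: s_def[abs_def])
  define G where "G k = integral {-R..R} (\<lambda>y. (s k * nderiv 1 a (z + s k * y) * F y + 2 * a (z + s k * y) * F1 y
          - b (z + s k * y) / s k * F y)\<^sup>2 / (4 * a (z + s k * y)))" for k
  have "\<forall>\<^sub>F k in sequentially. G k < max 0 (nderiv 1 b z) + d"
    using order_tendstoD(2)[OF rescaled_energy_tendsto[OF a b cF F(2) s(1) s0 R]] cost R2 d
    by (auto simp: G_def[abs_def])
  moreover have "(\<lambda>k. s k * R) \<longlonglongrightarrow> 0 * R" by (intro tendsto_intros s0)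
  then have "\<forall>\<^sub>F k in sequentially. s k * R < d" using d by (intro order_tendstoD(2)) auto
  ultimately show ?thesis
  proof eventually_elim
    case (elim k)
    define \<rho> where "\<rho> x = indicator {-R..R} ((x - z) / s k) * (F ((x - z) / s k))\<^sup>2 / s k" for x
    note I = rescaled_density_integral[OF _ cF s(1), of _ R z k, folded \<rho>_def]
    have [measurable]: "F \<in> borel_measurable borel" using cF by (rule borel_measurable_continuous_onI)
    have "\<rho> \<in> borel_measurable borel" unfolding \<rho>_def[abs_def] by measurable
    moreover have "\<rho> x \<ge> 0" for x using s(1)[of k] by (simp add: \<rho>_def less_imp_le)
    moreover have one: "(LINT x|lborel. \<rho> x) = 1" using I[of "\<lambda>_. 1"] F2 by simp
    moreover have "integrable lborel \<rho>" using one not_integrable_integral_eq[of lborel \<rho>] by auto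
    moreover have "\<bar>x - z\<bar> \<le> d" if "\<rho> x \<noteq> 0" for x
    proof -
      have "\<bar>(x - z) / s k\<bar> \<le> R" using that by (auto simp: \<rho>_def indicator_def split: if_splits)
      then have "\<bar>x - z\<bar> \<le> s k * R" using s(1)[of k] by (simp add: field_simps)
      then show ?thesis using elim(2) by simp
    qed
    moreover have "- (LINT x|lborel. (e k * a x * nderiv 2 u x + b x * nderiv 1 u x) / u x * \<rho> x) \<le> max 0 (nderiv 1 b z) + d"
      if u: "u \<in> C_circle 2" "\<And>x. u x > 0" for u
    proof -
      have "u x \<noteq> 0" for x using u(2)[of x] by simp
      then have cg: "continuous_on UNIV (\<lambda>x. (e k * a x * nderiv 2 u x + b x * nderiv 1 u x) / u x)"
        using C_circle_2D(1-3)[OF u(1)] C_circle_2D(1)[OF a(1)] C_circle_2D(1)[OF b(1)]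
        by (auto simp: C_circle_0_iff simp del: One_nat_def intro!: continuous_intros)
      have "- (LINT x|lborel. (e k * a x * nderiv 2 u x + b x * nderiv 1 u x) / u x * \<rho> x) \<le> G k"
        using rescaled_energy_bound[OF a C_circle_2D(1)[OF b(1)] u F s(1) R, of k z]
        unfolding I[OF cg] G_def s(2) .
      then show ?thesis using elim(1) by simp
    qed
    ultimately show ?case unfolding recovery_density_def by blast
  qed
qed

section \<open>From densities on the line to probability measures on the circle\<close>

definition circle_measure :: "(real \<Rightarrow> real) \<Rightarrow> real measure" where
  "circle_measure \<rho> = distr (density lborel (\<lambda>x. ennreal (\<rho> x))) borel frac"

lemma borel_measurable_frac [measurable]: "(frac :: real \<Rightarrow> real) \<in> borel_measurable borel"
  unfolding frac_def[abs_def] by measurable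

lemma circle_measure_P_circle:
  assumes [measurable]: "\<rho> \<in> borel_measurable borel" and \<rho>: "\<And>x. \<rho> x \<ge> 0" "integrable lborel \<rho>" "(LINT x|lborel. \<rho> x) = 1"
  shows "circle_measure \<rho> \<in> P_circle"
proof -
  have "(\<integral>\<^sup>+x. ennreal (\<rho> x) \<partial>lborel) = 1"
    using nn_integral_eq_integral[OF \<rho>(2)] \<rho> by simp
  then interpret D: prob_space "density lborel (\<lambda>x. ennreal (\<rho> x))"
    by (intro prob_spaceI) (simp add: emeasure_density)
  have "frac -` {0..<1::real} = UNIV" using frac_lt_1 by auto
  then have "measure (circle_measure \<rho>) {0..<1} = 1"
    unfolding circle_measure_def using D.prob_space by (subst measure_distr) auto
  moreover have "real_distribution (circle_measure \<rho>)"
    unfolding circle_measure_def by (rule D.real_distribution_distr) measurable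
  ultimately show ?thesis by (simp add: P_circle_def)
qed

lemma C_circle_0_measurable: "f \<in> C_circle 0 \<Longrightarrow> f \<in> borel_measurable borel" for f :: "real \<Rightarrow> real"
  by (auto simp: C_circle_0_iff intro: borel_measurable_continuous_onI)

lemma circle_measure_integral:
  assumes [measurable]: "\<rho> \<in> borel_measurable borel" and \<rho>: "\<And>x. \<rho> x \<ge> 0" and f: "f \<in> C_circle 0"
  shows "(LINT x|circle_measure \<rho>. f x) = (LINT x|lborel. f x * \<rho> x)"
proof -
  have [measurable]: "f \<in> borel_measurable borel" using f by (rule C_circle_0_measurable)
  have "(LINT x|circle_measure \<rho>. f x) = (LINT x|density lborel (\<lambda>x. ennreal (\<rho> x)). f (frac x))"
    unfolding circle_measure_def by (rule integral_distr) auto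
  also have "\<dots> = (LINT x|lborel. \<rho> x *\<^sub>R f (frac x))" using \<rho> by (intro integral_density) auto
  finally show ?thesis using C_circle_0_frac[OF f] by (simp add: mult.commute)
qed

lemma P_circle_D:
  assumes "\<mu> \<in> P_circle"
  shows "prob_space \<mu>" "sets \<mu> = sets borel" "measure \<mu> {0..<1} = 1"
proof -
  have r: "real_distribution \<mu>" using assms by (simp add: P_circle_def)
  show "prob_space \<mu>" using r by (simp add: real_distribution_def)
  show "sets \<mu> = sets borel" using real_distribution.events_eq_borel[OF r] .
  show "measure \<mu> {0..<1} = 1" using assms by (simp add: P_circle_def)
qed

lemma P_circle_integrable:
  fixes f :: "real \<Rightarrow> real"
  assumes "\<mu> \<in> P_circle" and f: "f \<in> C_circle 0"
  shows "integrable \<mu> f"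
proof -
  interpret prob_space \<mu> using assms P_circle_D by blast
  obtain M where "\<And>x. \<bar>f x\<bar> \<le> M" using C_circle_0_bounded[OF f] by blast
  moreover have "f \<in> borel_measurable \<mu>"
    using C_circle_0_measurable[OF f] measurable_cong_sets[OF P_circle_D(2)[OF assms(1)] refl] by blast
  ultimately show ?thesis by (intro integrable_const_bound[of f M]) auto
qed

lemma I_fun_ge:
  fixes a b c :: "real \<Rightarrow> real"
  assumes a: "a \<in> C_circle 0" "\<And>x. a x > 0" and b: "b \<in> C_circle 0" and c: "c \<in> C_circle 0" and e: "\<epsilon> > 0"
    and \<mu>: "\<mu> \<in> P_circle"
  shows "ereal ((LINT x|\<mu>. c x) - principal_eigenvalue a b c \<epsilon>) \<le> I_fun a b \<epsilon> \<mu>"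
proof -
  interpret prob_space \<mu> using \<mu> P_circle_D by blast
  define l where "l = principal_eigenvalue a b c \<epsilon>"
  obtain u where u: "u \<in> C_circle 2" "\<And>x. u x > 0"
    and eq: "\<And>x. \<epsilon> * a x * nderiv 2 u x + b x * nderiv 1 u x + c x * u x = l * u x"
    using principal_eigenfunction[OF a b c e] unfolding l_def by metis
  have "(\<epsilon> * a x * nderiv 2 u x + b x * nderiv 1 u x) / u x = l - c x" for x
  proof -
    have "\<epsilon> * a x * nderiv 2 u x + b x * nderiv 1 u x = (l - c x) * u x"
      unfolding left_diff_distrib using eq[of x] by linarith
    then show ?thesis using u(2)[of x] by simp
  qed
  then have "(LINT x|\<mu>. (\<epsilon> * a x * nderiv 2 u x + b x * nderiv 1 u x) / u x) = (LINT x|\<mu>. l - c x)" by simp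
  also have "\<dots> = l - (LINT x|\<mu>. c x)"
    using P_circle_integrable[OF \<mu> c] by (simp add: prob_space)
  finally have "ereal ((LINT x|\<mu>. c x) - l) = ereal (- (LINT x|\<mu>. (\<epsilon> * a x * nderiv 2 u x + b x * nderiv 1 u x) / u x))"
    by simp
  also have "\<dots> \<le> I_fun a b \<epsilon> \<mu>"
    unfolding I_fun_def using u by (intro SUP_upper) auto
  finally show ?thesis by (simp add: l_def)
qed

section \<open>Limit of the principal eigenvalue and \<open>\<Gamma>\<close>-convergence\<close>

lemma diagonal_sequence:
  fixes P :: "nat \<Rightarrow> nat \<Rightarrow> bool"
  assumes P: "\<And>n. \<forall>\<^sub>F k in sequentially. P n k"
  shows "\<exists>m. filterlim m at_top sequentially \<and> (\<forall>\<^sub>F k in sequentially. P (m k) k)"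
proof -
  \<comment> \<open>The maximum of \<open>S k\<close> is the best index available at stage k. The
    inserted 0 is the default when no index qualifies; it is a valid choice eventually, because
    \<open>P 0 k\<close> holds eventually.\<close>
  define S where "S k = insert 0 {n. n \<le> k \<and> P n k}" for k
  have fin: "finite (S k)" "S k \<noteq> {}" for k by (auto simp: S_def)
  have "\<forall>\<^sub>F k in sequentially. n \<le> Max (S k)" for n
    using P[of n] eventually_ge_at_top[of n]
    by eventually_elim (auto simp: S_def intro!: Max_ge)
  then have "filterlim (\<lambda>k. Max (S k)) at_top sequentially" by (simp add: filterlim_at_top)
  moreover have "\<forall>\<^sub>F k in sequentially. P (Max (S k)) k"
    using P[of 0]
  proof eventually_elim
    case (elim k)
    then show ?case using Max_in[OF fin(1)[of k] fin(2)[of k]] by (auto simp: S_def)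
  qed
  ultimately show ?thesis by blast
qed

lemma zero_in_unit_interval:
  assumes "b \<in> C_circle 0" "b x0 > 0" "b x1 < (0 :: real)"
  shows "\<exists>z \<in> {0..<1}. b z = 0"
proof -
  have "connected (b ` UNIV)"
    using assms(1) by (intro connected_continuous_image) (auto simp: C_circle_0_iff)
  moreover have "b x0 \<in> b ` UNIV" "b x1 \<in> b ` UNIV" by auto
  ultimately have "0 \<in> b ` UNIV"
    using connectedD_interval[of "b ` UNIV" "b x1" "b x0" 0] assms by simp
  then obtain z where "b z = 0" by auto
  then show ?thesis
    using C_circle_0_frac[OF assms(1), of z] frac_lt_1[of z] by (intro bexI[of _ "frac z"]) auto
qed

text \<open>For a fixed u the quantity under the supremum is linear in the measure, so the bounds
  average with weights \<open>p z\<close>, and the result still does not depend on u. The last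
  conclusion measures closeness to the mixture of Dirac masses by the oscillation
  \<open>\<eta>\<close> of \<open>f\<close> at distance \<open>d\<close> from
  \<open>Z\<close>.\<close>

lemma recovery_mixture:
  fixes a b :: "real \<Rightarrow> real" and p :: "real \<Rightarrow> real"
  assumes a: "a \<in> C_circle 0" and b: "b \<in> C_circle 0" and Z: "finite Z"
    and p: "\<And>z. z \<in> Z \<Longrightarrow> p z \<ge> 0" "sum p Z = 1"
    and r: "\<And>z. z \<in> Z \<Longrightarrow> recovery_density a b z \<epsilon> d (\<rho> z)"
  obtains \<nu> where "\<nu> \<in> P_circle" "I_fun a b \<epsilon> \<nu> \<le> ereal ((\<Sum>z\<in>Z. p z * max 0 (nderiv 1 b z)) + d)"
    "\<And>f \<eta>. f \<in> C_circle 0 \<Longrightarrow> (\<And>z x. z \<in> Z \<Longrightarrow> \<bar>x - z\<bar> \<le> d \<Longrightarrow> \<bar>f x - f z\<bar> \<le> \<eta>) \<Longrightarrow>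
      \<bar>(LINT x|\<nu>. f x) - (\<Sum>z\<in>Z. p z * f z)\<bar> \<le> \<eta>"
proof -
  define \<rho>' where "\<rho>' x = (\<Sum>z\<in>Z. p z * \<rho> z x)" for x
  have rm: "\<rho> z \<in> borel_measurable borel" and r0: "\<rho> z x \<ge> 0" and ri: "integrable lborel (\<rho> z)"
    and r1: "(LINT x|lborel. \<rho> z x) = 1" and rs: "\<rho> z x \<noteq> 0 \<Longrightarrow> \<bar>x - z\<bar> \<le> d" if "z \<in> Z" for z x
    using r[OF that] by (auto simp: recovery_density_def)
  have fi: "integrable lborel (\<lambda>x. f x * \<rho> z x)" if f: "f \<in> C_circle 0" and z: "z \<in> Z" for f z
  proof -
    obtain M where M: "M > 0" "\<And>x. \<bar>f x\<bar> \<le> M" using C_circle_0_bounded[OF f] by blast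
    have [measurable]: "f \<in> borel_measurable borel" "\<rho> z \<in> borel_measurable borel"
      using C_circle_0_measurable[OF f] rm[OF z] by auto
    show ?thesis
    proof (rule Bochner_Integration.integrable_bound[OF integrable_mult_right[OF ri[OF z], of M]])
      show "(\<lambda>x. f x * \<rho> z x) \<in> borel_measurable lborel" by measurable
      show "AE x in lborel. norm (f x * \<rho> z x) \<le> norm (M * \<rho> z x)"
        using M r0[OF z] by (auto simp: abs_mult intro!: mult_right_mono)
    qed
  qed
  have \<rho>'m: "\<rho>' \<in> borel_measurable borel"
    unfolding \<rho>'_def[abs_def] using rm by (intro borel_measurable_sum borel_measurable_times) auto
  have \<rho>'0: "\<rho>' x \<ge> 0" for x
    unfolding \<rho>'_def using p r0 by (intro sum_nonneg mult_nonneg_nonneg) auto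
  have fsum: "(LINT x|lborel. f x * \<rho>' x) = (\<Sum>z\<in>Z. p z * (LINT x|lborel. f x * \<rho> z x))"
    if f: "f \<in> C_circle 0" for f
  proof -
    have "(LINT x|lborel. f x * \<rho>' x) = (LINT x|lborel. (\<Sum>z\<in>Z. p z * (f x * \<rho> z x)))"
      by (simp add: \<rho>'_def sum_distrib_left algebra_simps)
    also have "\<dots> = (\<Sum>z\<in>Z. (LINT x|lborel. p z * (f x * \<rho> z x)))"
      by (intro Bochner_Integration.integral_sum integrable_mult_right fi f)
    finally show ?thesis by simp
  qed
  have "(LINT x|lborel. 1 * \<rho>' x) = 1"
    using fsum[OF C_circle_0_const[of 1]] r1 p by simp
  moreover have "integrable lborel \<rho>'"
    unfolding \<rho>'_def[abs_def] using ri by (intro Bochner_Integration.integrable_sum integrable_mult_right) auto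
  ultimately have P: "circle_measure \<rho>' \<in> P_circle"
    by (intro circle_measure_P_circle \<rho>'m \<rho>'0) auto
  have int: "(LINT x|circle_measure \<rho>'. f x) = (\<Sum>z\<in>Z. p z * (LINT x|lborel. f x * \<rho> z x))"
    if f: "f \<in> C_circle 0" for f
    by (simp add: circle_measure_integral[OF \<rho>'m \<rho>'0 f] fsum[OF f])
  show ?thesis
  proof (rule that[OF P])
    show "I_fun a b \<epsilon> (circle_measure \<rho>') \<le> ereal ((\<Sum>z\<in>Z. p z * max 0 (nderiv 1 b z)) + d)"
      unfolding I_fun_def
    proof (rule SUP_least)
      fix u :: "real \<Rightarrow> real" assume "u \<in> {u \<in> C_circle 2. \<forall>x. u x > 0}"
      then have u: "u \<in> C_circle 2" "\<And>x. u x > 0" by auto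
      define g where "g x = (\<epsilon> * a x * nderiv 2 u x + b x * nderiv 1 u x) / u x" for x
      have "u x \<noteq> 0" for x using u(2)[of x] by simp
      then have gC: "g \<in> C_circle 0"
        unfolding g_def[abs_def] by (intro C_circle_0_arith C_circle_0_const a b C_circle_2D[OF u(1)])
      have "- (LINT x|circle_measure \<rho>'. g x) = (\<Sum>z\<in>Z. p z * - (LINT x|lborel. g x * \<rho> z x))"
        by (simp add: int[OF gC] sum_negf)
      also have "\<dots> \<le> (\<Sum>z\<in>Z. p z * (max 0 (nderiv 1 b z) + d))"
        using r u p(1) by (intro sum_mono mult_left_mono) (auto simp: recovery_density_def g_def simp del: One_nat_def)
      also have "\<dots> = (\<Sum>z\<in>Z. p z * max 0 (nderiv 1 b z)) + d"
        using p(2) by (simp add: distrib_left sum.distrib sum_distrib_right[symmetric])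
      finally show "ereal (- (LINT x|circle_measure \<rho>'. (\<epsilon> * a x * nderiv 2 u x + b x * nderiv 1 u x) / u x))
          \<le> ereal ((\<Sum>z\<in>Z. p z * max 0 (nderiv 1 b z)) + d)"
        by (simp add: g_def)
    qed
  next
    fix f :: "real \<Rightarrow> real" and \<eta> :: real
    assume f: "f \<in> C_circle 0" and \<eta>: "\<And>z x. z \<in> Z \<Longrightarrow> \<bar>x - z\<bar> \<le> d \<Longrightarrow> \<bar>f x - f z\<bar> \<le> \<eta>"
    have one: "\<bar>(LINT x|lborel. f x * \<rho> z x) - f z\<bar> \<le> \<eta>" if z: "z \<in> Z" for z
    proof -
      have "(LINT x|lborel. f x * \<rho> z x) - f z = (LINT x|lborel. f x * \<rho> z x) - (LINT x|lborel. f z * \<rho> z x)"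
        using r1[OF z] by simp
      also have "\<dots> = (LINT x|lborel. f x * \<rho> z x - f z * \<rho> z x)"
        by (rule Bochner_Integration.integral_diff[symmetric, OF fi[OF f z] integrable_mult_right[OF ri[OF z]]])
      finally have "norm ((LINT x|lborel. f x * \<rho> z x) - f z) \<le> (LINT x|lborel. norm (f x * \<rho> z x - f z * \<rho> z x))"
        by (metis integral_norm_bound)
      also have "\<dots> \<le> (LINT x|lborel. \<eta> * \<rho> z x)"
      proof (rule integral_mono)
        show "integrable lborel (\<lambda>x. norm (f x * \<rho> z x - f z * \<rho> z x))"
          using fi[OF f z] ri[OF z] by (intro integrable_norm Bochner_Integration.integrable_diff integrable_mult_right)
        show "integrable lborel (\<lambda>x. \<eta> * \<rho> z x)" using ri[OF z] by simp
        fix x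
        have "norm (f x * \<rho> z x - f z * \<rho> z x) = \<bar>f x - f z\<bar> * \<rho> z x"
          using r0[OF z, of x] by (simp add: left_diff_distrib[symmetric] abs_mult)
        also have "\<dots> \<le> \<eta> * \<rho> z x"
          using \<eta>[OF z] rs[OF z, of x] r0[OF z, of x] by (cases "\<rho> z x = 0") (auto intro!: mult_right_mono)
        finally show "norm (f x * \<rho> z x - f z * \<rho> z x) \<le> \<eta> * \<rho> z x" .
      qed
      finally show ?thesis using r1[OF z] by simp
    qed
    have "(LINT x|circle_measure \<rho>'. f x) - (\<Sum>z\<in>Z. p z * f z) = (\<Sum>z\<in>Z. p z * ((LINT x|lborel. f x * \<rho> z x) - f z))"
      by (simp add: int[OF f] right_diff_distrib sum_subtractf)
    also have "\<bar>\<dots>\<bar> \<le> (\<Sum>z\<in>Z. p z * \<bar>(LINT x|lborel. f x * \<rho> z x) - f z\<bar>)"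
      using p(1) by (intro order_trans[OF sum_abs] sum_mono) (simp add: abs_mult)
    also have "\<dots> \<le> (\<Sum>z\<in>Z. p z * \<eta>)" using p(1) one by (intro sum_mono mult_left_mono) auto
    also have "\<dots> = \<eta>" using p(2) by (simp add: sum_distrib_right[symmetric])
    finally show "\<bar>(LINT x|circle_measure \<rho>'. f x) - (\<Sum>z\<in>Z. p z * f z)\<bar> \<le> \<eta>" .
  qed
qed

text \<open>For each fixed tolerance d suitable measures exist only from some stage on. A diagonal
  choice lets d tend to 0 along the sequence and so removes it from both limits.\<close>

lemma recovery_sequence:
  fixes a b p :: "real \<Rightarrow> real" and e :: "nat \<Rightarrow> real"
  assumes a: "a \<in> C_circle 2" "\<And>x. a x > 0" and b: "b \<in> C_circle 2"
    and Z: "finite Z" "\<And>z. z \<in> Z \<Longrightarrow> b z = 0"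
    and p: "\<And>z. z \<in> Z \<Longrightarrow> p z \<ge> 0" "sum p Z = 1"
    and e: "\<And>k. e k > 0" "e \<longlonglongrightarrow> 0"
  obtains \<nu> where "\<And>k. \<nu> k \<in> P_circle"
    "\<And>f. f \<in> C_circle 0 \<Longrightarrow> (\<lambda>k. LINT x|\<nu> k. f x) \<longlonglongrightarrow> (\<Sum>z\<in>Z. p z * f z)"
    "\<And>d. d > 0 \<Longrightarrow> \<forall>\<^sub>F k in sequentially. I_fun a b (e k) (\<nu> k) \<le> ereal ((\<Sum>z\<in>Z. p z * max 0 (nderiv 1 b z)) + d)"
proof -
  define B where "B = (\<Sum>z\<in>Z. p z * max 0 (nderiv 1 b z))"
  define good where "good k d \<nu> \<longleftrightarrow> \<nu> \<in> P_circle \<and> I_fun a b (e k) \<nu> \<le> ereal (B + d) \<and>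
    (\<forall>f \<eta>. f \<in> C_circle 0 \<longrightarrow> (\<forall>z x. z \<in> Z \<longrightarrow> \<bar>x - z\<bar> \<le> d \<longrightarrow> \<bar>f x - f z\<bar> \<le> \<eta>) \<longrightarrow>
      \<bar>(LINT x|\<nu>. f x) - (\<Sum>z\<in>Z. p z * f z)\<bar> \<le> \<eta>)" for k d \<nu>
  have ev: "\<forall>\<^sub>F k in sequentially. \<exists>\<nu>. good k d \<nu>" if d: "d > 0" for d
  proof -
    have "\<forall>\<^sub>F k in sequentially. \<forall>z\<in>Z. \<exists>\<rho>. recovery_density a b z (e k) d \<rho>"
      using Z eventually_recovery_density[OF a b _ e d] by (intro eventually_ball_finite) auto
    then show ?thesis
    proof eventually_elim
      case (elim k)
      then obtain \<rho> where \<rho>: "\<And>z. z \<in> Z \<Longrightarrow> recovery_density a b z (e k) d (\<rho> z)" by metis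
      show ?case
        by (rule recovery_mixture[OF C_circle_2D(1)[OF a(1)] C_circle_2D(1)[OF b] Z(1) p \<rho>, folded B_def])
          (auto simp: good_def)
    qed
  qed
  have good_P: "\<nu> \<in> P_circle" if "good k d \<nu>" for k d \<nu> using that by (simp add: good_def)
  have good_mono: "good k d' \<nu>" if "good k d \<nu>" "d \<le> d'" for k d d' \<nu>
  proof -
    have "I_fun a b (e k) \<nu> \<le> ereal (B + d')"
      using that by (auto simp: good_def intro: order_trans)
    then show ?thesis using that unfolding good_def by (meson order_trans)
  qed
  \<comment> \<open>Provides \<open>\<nu>0\<close>, a default probability measure for the finitely
    many stages at which no good measure may exist.\<close>
  have "\<exists>k \<nu>. good k 1 \<nu>"
    using eventually_happens'[OF sequentially_bot ev[OF zero_less_one]] by blast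
  then obtain k0 \<nu>0 where "good k0 1 \<nu>0" by blast
  then have \<nu>0: "\<nu>0 \<in> P_circle" by (rule good_P)
  \<comment> \<open>Tolerances 1/(n+1) serve for the diagonal choice; \<open>good_mono\<close> then
    recovers every fixed tolerance.\<close>
  have "\<forall>\<^sub>F k in sequentially. \<exists>\<nu>. good k (1 / (real n + 1)) \<nu>" for n by (rule ev) simp
  from diagonal_sequence[of "\<lambda>n k. \<exists>\<nu>. good k (1 / (real n + 1)) \<nu>", OF this]
  obtain m where m: "filterlim m at_top sequentially"
    and mg: "\<forall>\<^sub>F k in sequentially. \<exists>\<nu>. good k (1 / (real (m k) + 1)) \<nu>" by (elim exE conjE)
  define \<nu> where "\<nu> k = (if \<exists>\<nu>. good k (1 / (real (m k) + 1)) \<nu> then SOME \<nu>. good k (1 / (real (m k) + 1)) \<nu> else \<nu>0)" for k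
  have \<nu>g: "\<forall>\<^sub>F k in sequentially. good k (1 / (real (m k) + 1)) (\<nu> k)"
    using mg
  proof eventually_elim
    case (elim k)
    from someI_ex[OF this] elim show ?case unfolding \<nu>_def by simp
  qed
  have good_ev: "\<forall>\<^sub>F k in sequentially. good k d (\<nu> k)" if "d > 0" for d
  proof -
    obtain N where N: "1 / d < real N" using reals_Archimedean2 by blast
    have "\<forall>\<^sub>F k in sequentially. N \<le> m k" using m by (simp add: filterlim_at_top)
    with \<nu>g show ?thesis
    proof eventually_elim
      case (elim k)
      have "1 < real N * d" using N that by (simp add: field_simps)
      also have "\<dots> \<le> (real (m k) + 1) * d" using elim that by (intro mult_right_mono) auto
      finally have "1 / (real (m k) + 1) \<le> d" by (simp add: field_simps)
      then show ?case using good_mono elim by blast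
    qed
  qed
  show ?thesis
  proof (rule that)
    show "\<nu> k \<in> P_circle" for k
    proof (cases "\<exists>\<nu>. good k (1 / (real (m k) + 1)) \<nu>")
      case True
      then show ?thesis using good_P[OF someI_ex[OF True]] by (simp add: \<nu>_def)
    qed (simp add: \<nu>_def \<nu>0)
    show "\<forall>\<^sub>F k in sequentially. I_fun a b (e k) (\<nu> k) \<le> ereal ((\<Sum>z\<in>Z. p z * max 0 (nderiv 1 b z)) + d)"
      if "d > 0" for d
      using good_ev[OF that] by eventually_elim (simp add: good_def B_def)
    fix f :: "real \<Rightarrow> real" assume f: "f \<in> C_circle 0"
    show "(\<lambda>k. LINT x|\<nu> k. f x) \<longlonglongrightarrow> (\<Sum>z\<in>Z. p z * f z)"
    proof (rule tendstoI)
      fix \<eta> :: real assume \<eta>: "\<eta> > 0"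
      have "\<forall>\<^sub>F d in at_right (0::real). \<forall>z\<in>Z. \<forall>x. \<bar>x - z\<bar> \<le> d \<longrightarrow> \<bar>f x - f z\<bar> \<le> \<eta> / 2"
      proof (intro eventually_ball_finite Z ballI)
        fix z assume "z \<in> Z"
        have "isCont f z" using f by (simp add: C_circle_0_iff continuous_on_eq_continuous_at)
        then obtain d where d: "d > 0" "\<And>x. dist x z < d \<Longrightarrow> dist (f x) (f z) < \<eta> / 2"
          using \<eta> unfolding continuous_at_eps_delta by (metis half_gt_zero)
        have "\<forall>\<^sub>F d' in at_right (0::real). d' < d" using d(1) by (intro eventually_at_rightI[of 0 d]) auto
        then show "\<forall>\<^sub>F d in at_right (0::real). \<forall>x. \<bar>x - z\<bar> \<le> d \<longrightarrow> \<bar>f x - f z\<bar> \<le> \<eta> / 2"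
          by eventually_elim (use d(2) in \<open>auto simp: dist_real_def intro!: less_imp_le\<close>)
      qed
      then obtain D where D: "D > 0" "\<And>d. d > 0 \<Longrightarrow> d < D \<Longrightarrow> \<forall>z\<in>Z. \<forall>x. \<bar>x - z\<bar> \<le> d \<longrightarrow> \<bar>f x - f z\<bar> \<le> \<eta> / 2"
        unfolding eventually_at_right_field by blast
      define d where "d = D / 2"
      have d: "d > 0" "\<forall>z x. z \<in> Z \<longrightarrow> \<bar>x - z\<bar> \<le> d \<longrightarrow> \<bar>f x - f z\<bar> \<le> \<eta> / 2"
        using D(1) D(2)[of d] by (simp_all add: d_def)
      from good_ev[OF d(1)] show "\<forall>\<^sub>F k in sequentially. dist (LINT x|\<nu> k. f x) (\<Sum>z\<in>Z. p z * f z) < \<eta>"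
      proof eventually_elim
        case (elim k)
        then have "\<bar>(LINT x|\<nu> k. f x) - (\<Sum>z\<in>Z. p z * f z)\<bar> \<le> \<eta> / 2" using f d(2) unfolding good_def by blast
        then show ?case using \<eta> by (simp add: dist_real_def)
      qed
    qed
  qed
qed

section \<open>The formula for \<open>Lambda\<close>\<close>

definition max_zero_value :: "(real \<Rightarrow> real) \<Rightarrow> (real \<Rightarrow> real) \<Rightarrow> real" where
  "max_zero_value b c = Max ((\<lambda>z. c z - max 0 (nderiv 1 b z)) ` {z \<in> {0..<1}. b z = 0})"

text \<open>For the lower half, \<open>I_fun_ge\<close> is read as a lower bound on the eigenvalue:
  it is at least the integral of c minus \<open>I_fun\<close>, for any probability measure. Measures
  concentrating at a zero \<open>z\<close> that realises the maximum make this tend to at least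
  \<open>m\<close>.\<close>

lemma principal_eigenvalue_tendsto:
  fixes a b c :: "real \<Rightarrow> real"
  assumes a: "a \<in> C_circle 2" "\<And>x. a x > 0" and b: "b \<in> C_circle 2" "b x0 > 0" "b x1 < 0"
    and fin: "finite {z \<in> {0..<1}. b z = 0}" and c: "c \<in> C_circle 0"
  shows "(principal_eigenvalue a b c \<longlongrightarrow> max_zero_value b c) (at_right 0)"
proof -
  define Z where "Z = {z \<in> {0..<1}. b z = 0}"
  define h where "h z = c z - max 0 (nderiv 1 b z)" for z
  define m where "m = max_zero_value b c"
  note aC = C_circle_2D(1)[OF a(1)] and bC = C_circle_2D(1,2)[OF b(1)]
  have Z: "finite Z" "Z \<noteq> {}" using fin zero_in_unit_interval[OF bC(1) b(2,3)] by (auto simp: Z_def)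
  have m: "m = Max (h ` Z)" by (simp add: m_def max_zero_value_def h_def Z_def)
  have hm: "h x \<le> m" if "b x = 0" for x
  proof -
    have hC: "h \<in> C_circle 0" unfolding h_def[abs_def] by (intro C_circle_0_arith C_circle_0_const c bC)
    have "frac x \<in> Z" using that C_circle_0_frac[OF bC(1), of x] frac_lt_1[of x] by (simp add: Z_def)
    then have "h (frac x) \<le> m" unfolding m using Z by (intro Max_ge) auto
    then show ?thesis using C_circle_0_frac[OF hC, of x] by simp
  qed
  have "m \<in> h ` Z" unfolding m using Z by (intro Max_in) auto
  then obtain z where z: "z \<in> Z" "m = h z" by auto
  have "(principal_eigenvalue a b c \<circ> e) \<longlonglongrightarrow> m" if e: "\<And>k. e k > 0" "e \<longlonglongrightarrow> 0" for e :: "nat \<Rightarrow> real"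
  proof (rule tendstoI)
    fix \<eta> :: real assume \<eta>: "\<eta> > 0"
    obtain \<epsilon>0 where \<epsilon>0: "\<epsilon>0 > 0" "\<And>\<epsilon>. \<epsilon> > 0 \<Longrightarrow> \<epsilon> < \<epsilon>0 \<Longrightarrow> principal_eigenvalue a b c \<epsilon> \<le> m + \<eta> / 2"
      using principal_eigenvalue_upper_bound[OF a b c, of m "\<eta> / 2"] hm \<eta> unfolding h_def by (auto simp del: One_nat_def)
    have ev1: "\<forall>\<^sub>F k in sequentially. e k < \<epsilon>0" using e(2) \<epsilon>0(1) by (rule order_tendstoD)
    \<comment> \<open>The recovery sequence of a single Dirac mass: \<open>Z = {z}\<close> with
      weight 1.\<close>
    have fz: "finite {z}" and sz: "(\<Sum>y\<in>{z}. 1) = (1 :: real)" by simp_all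
    have bz: "b y = 0" if "y \<in> {z}" for y using that z(1) by (simp add: Z_def)
    obtain \<nu> where \<nu>: "\<And>k. \<nu> k \<in> P_circle"
      "\<And>f :: real \<Rightarrow> real. f \<in> C_circle 0 \<Longrightarrow> (\<lambda>k. LINT x|\<nu> k. f x) \<longlonglongrightarrow> (\<Sum>y\<in>{z}. 1 * f y)"
      "\<And>d. d > 0 \<Longrightarrow> \<forall>\<^sub>F k in sequentially. I_fun a b (e k) (\<nu> k) \<le> ereal ((\<Sum>y\<in>{z}. 1 * max 0 (nderiv 1 b y)) + d)"
      by (rule recovery_sequence[where Z = "{z}" and p = "\<lambda>_. 1", OF a b(1) fz bz zero_le_one sz e], assumption) (rule that, blast+)
    have \<nu>3: "\<forall>\<^sub>F k in sequentially. I_fun a b (e k) (\<nu> k) \<le> ereal (max 0 (nderiv 1 b z) + d)" if "d > 0" for d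
      using \<nu>(3)[OF that] by simp
    from \<nu>(2)[OF c] have "(\<lambda>k. LINT x|\<nu> k. c x) \<longlonglongrightarrow> c z" by simp
    then have ev2: "\<forall>\<^sub>F k in sequentially. (LINT x|\<nu> k. c x) > c z - \<eta> / 2"
      using \<eta> by (intro order_tendstoD(1)) auto
    \<comment> \<open>Tolerances \<eta>/2 for the integral of \<open>c\<close> and \<eta>/3 for
      \<open>I_fun\<close> sum to less than \<eta>, as the strict inequality requires.\<close>
    have "\<eta> / 3 > 0" using \<eta> by simp
    from ev1 ev2 \<nu>3[OF this] show "\<forall>\<^sub>F k in sequentially. dist ((principal_eigenvalue a b c \<circ> e) k) m < \<eta>"
    proof eventually_elim
      case (elim k)
      have "ereal ((LINT x|\<nu> k. c x) - principal_eigenvalue a b c (e k)) \<le> ereal (max 0 (nderiv 1 b z) + \<eta> / 3)"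
        using elim(3) by (rule order_trans[OF I_fun_ge[OF aC a(2) bC(1) c e(1) \<nu>(1)]])
      then have "principal_eigenvalue a b c (e k) > m - \<eta>"
        using elim(2) z(2) \<eta> by (simp add: h_def del: One_nat_def)
      then show ?case using \<epsilon>0(2)[OF e(1) elim(1)] \<eta> by (simp add: dist_real_def)
    qed
  qed
  then show ?thesis unfolding tendsto_at_iff_sequentially m_def by auto
qed

lemma Lambda_eq:
  fixes a b c :: "real \<Rightarrow> real"
  assumes "a \<in> C_circle 2" "\<And>x. a x > 0" "b \<in> C_circle 2" "b x0 > 0" "b x1 < 0"
    "finite {z \<in> {0..<1}. b z = 0}" "c \<in> C_circle 0"
  shows "Lambda a b c = max_zero_value b c"
  unfolding Lambda_def by (rule tendsto_Lim[OF _ principal_eigenvalue_tendsto[OF assms]]) simp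

lemma J_fun_ge:
  fixes a b c :: "real \<Rightarrow> real"
  assumes "c \<in> C_circle 0"
  shows "ereal ((LINT x|\<mu>. c x) - Lambda a b c) \<le> J_fun a b \<mu>"
  unfolding J_fun_def using assms by (rule SUP_upper)

theorem proposition6p6:
  fixes \<sigma> a b :: "real \<Rightarrow> real"
  assumes "\<sigma> \<in> C_circle 2" and "b \<in> C_circle 2"
    and "\<And>x. a x = (\<sigma> x)\<^sup>2 / 2" and "\<And>x. a x > 0"
    and "\<exists>x. b x > 0" and "\<exists>x. b x < 0"
    and "finite {x \<in> {0..<1}. b x = 0}"
    and "\<And>x. x \<in> {0..<1} \<Longrightarrow> b x = 0 \<Longrightarrow> (\<exists>m. zero_of_order b x m) \<or> flat_zero b x"
  shows "Gamma_converges (I_fun a b) (J_fun a b)"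
proof -
  note b = assms(2) and a0 = assms(4)
  obtain x0 x1 where x01: "b x0 > 0" "b x1 < 0" using assms(5,6) by blast
  have aC2: "a \<in> C_circle 2"
  proof (rule C_circle_2I(1))
    note s = C_circle_2D_real[OF assms(1)] and sC = C_circle_2D(1-3)[OF assms(1)]
    have a: "a = (\<lambda>x. (\<sigma> x)\<^sup>2 / 2)" using assms(3) by auto
    show "a (x + 1) = a x" for x using sC(1) by (simp add: a C_circle_0_iff)
    show "(a has_vector_derivative \<sigma> x * nderiv 1 \<sigma> x) (at x)" for x
      unfolding a has_real_derivative_iff_has_vector_derivative[symmetric]
      by (auto intro!: derivative_eq_intros s simp del: One_nat_def)
    show "((\<lambda>x. \<sigma> x * nderiv 1 \<sigma> x) has_vector_derivative (nderiv 1 \<sigma> x)\<^sup>2 + \<sigma> x * nderiv 2 \<sigma> x) (at x)" for x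
      unfolding has_real_derivative_iff_has_vector_derivative[symmetric]
      by (auto intro!: derivative_eq_intros s simp: power2_eq_square simp del: One_nat_def)
    show "continuous_on UNIV (\<lambda>x. (nderiv 1 \<sigma> x)\<^sup>2 + \<sigma> x * nderiv 2 \<sigma> x)"
      using sC by (auto simp: C_circle_0_iff simp del: One_nat_def intro!: continuous_intros)
  qed
  note aC = C_circle_2D(1)[OF aC2] and bC = C_circle_2D(1,2)[OF b]
  define Z where "Z = {x \<in> {0..<1}. b x = 0}"
  have Z: "finite Z" "Z \<noteq> {}" using assms(7) zero_in_unit_interval[OF bC(1) x01] by (auto simp: Z_def)
  note L = Lambda_eq[OF aC2 a0 b x01 assms(7)]
  have lim: "(principal_eigenvalue a b c \<longlongrightarrow> Lambda a b c) (at_right 0)" if "c \<in> C_circle 0" for c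
    using principal_eigenvalue_tendsto[OF aC2 a0 b x01 assms(7) that] L[OF that] by simp
  \<comment> \<open>The test functions n b^2 vanish at all zeros of \<open>b\<close>, so their
    \<open>Lambda\<close> is at most 0, while their integrals against \<open>\<mu>\<close> grow
    linearly in n.\<close>
  have J_infinite: "J_fun a b \<mu> = \<infinity>" if \<mu>: "\<mu> \<in> P_circle" and pos: "(LINT x|\<mu>. (b x)\<^sup>2) > 0" for \<mu>
  proof (rule ereal_top)
    fix B :: real
    obtain n :: nat where n: "B / (LINT x|\<mu>. (b x)\<^sup>2) < real n" using reals_Archimedean2 by blast
    have cC: "(\<lambda>x. real n * (b x)\<^sup>2) \<in> C_circle 0"
      unfolding power2_eq_square by (intro C_circle_0_arith C_circle_0_const bC)
    have "max_zero_value b (\<lambda>x. real n * (b x)\<^sup>2) \<le> 0"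
      unfolding max_zero_value_def using Z by (subst Max_le_iff) (auto simp: Z_def)
    moreover have "B < real n * (LINT x|\<mu>. (b x)\<^sup>2)" using n pos by (simp add: field_simps)
    ultimately have "ereal B \<le> ereal ((LINT x|\<mu>. real n * (b x)\<^sup>2) - Lambda a b (\<lambda>x. real n * (b x)\<^sup>2))"
      by (simp add: L[OF cC])
    also have "\<dots> \<le> J_fun a b \<mu>" by (rule J_fun_ge[OF cC])
    finally show "ereal B \<le> J_fun a b \<mu>" .
  qed
  show ?thesis
    unfolding Gamma_converges_def
  proof (intro allI impI ballI conjI)
    fix e :: "nat \<Rightarrow> real" and \<mu> \<mu>s
    assume e: "(\<forall>k. e k > 0) \<and> e \<longlonglongrightarrow> 0" and \<mu>: "\<mu> \<in> P_circle"
      and \<mu>s: "(\<forall>k. \<mu>s k \<in> P_circle) \<and> weak_conv_circle \<mu>s \<mu>"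
    show "J_fun a b \<mu> \<le> liminf (\<lambda>k. I_fun a b (e k) (\<mu>s k))"
      unfolding J_fun_def
    proof (rule SUP_least)
      fix c :: "real \<Rightarrow> real" assume c: "c \<in> C_circle 0"
      \<comment> \<open>For a fixed \<open>c\<close> both the integral and the eigenvalue converge;
        the supremum over \<open>c\<close> is taken only after the limit.\<close>
      have "(principal_eigenvalue a b c \<circ> e) \<longlonglongrightarrow> Lambda a b c"
        using lim[OF c] e unfolding tendsto_at_iff_sequentially by auto
      then have "(\<lambda>k. ereal ((LINT x|\<mu>s k. c x) - principal_eigenvalue a b c (e k)))
          \<longlonglongrightarrow> ereal ((LINT x|\<mu>. c x) - Lambda a b c)"
        using \<mu>s c by (auto simp: weak_conv_circle_def o_def intro!: tendsto_intros)
      then have "ereal ((LINT x|\<mu>. c x) - Lambda a b c)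
          = liminf (\<lambda>k. ereal ((LINT x|\<mu>s k. c x) - principal_eigenvalue a b c (e k)))"
        using lim_imp_Liminf[OF sequentially_bot] by metis
      also have "\<dots> \<le> liminf (\<lambda>k. I_fun a b (e k) (\<mu>s k))"
        using e \<mu>s by (intro Liminf_mono always_eventually allI I_fun_ge aC a0 bC c) auto
      finally show "ereal ((LINT x|\<mu>. c x) - Lambda a b c) \<le> liminf (\<lambda>k. I_fun a b (e k) (\<mu>s k))" .
    qed
  next
    fix e :: "nat \<Rightarrow> real" and \<mu>
    assume e: "(\<forall>k. e k > 0) \<and> e \<longlonglongrightarrow> 0" and \<mu>: "\<mu> \<in> P_circle"
    interpret prob_space \<mu> using \<mu> P_circle_D by blast
    have b2C: "(\<lambda>x. (b x)\<^sup>2) \<in> C_circle 0" unfolding power2_eq_square by (intro C_circle_0_arith bC)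
    show "\<exists>\<mu>s. (\<forall>k. \<mu>s k \<in> P_circle) \<and> weak_conv_circle \<mu>s \<mu> \<and> limsup (\<lambda>k. I_fun a b (e k) (\<mu>s k)) \<le> J_fun a b \<mu>"
    proof (cases "(LINT x|\<mu>. (b x)\<^sup>2) = 0")
      case False
      then have "(LINT x|\<mu>. (b x)\<^sup>2) > 0" by (simp add: less_le)
      then have "J_fun a b \<mu> = \<infinity>" using J_infinite \<mu> by blast
      then show ?thesis using \<mu> by (intro exI[of _ "\<lambda>_. \<mu>"]) (auto simp: weak_conv_circle_def)
    next
      case True
      have sets: "A \<in> sets \<mu>" if "A \<in> sets borel" for A using P_circle_D(2)[OF \<mu>] that by simp
      have "AE x in \<mu>. (b x)\<^sup>2 = 0"
        using True integral_nonneg_eq_0_iff_AE[OF P_circle_integrable[OF \<mu> b2C]] by simp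
      moreover have "AE x in \<mu>. x \<in> {0..<1}"
        using P_circle_D(3)[OF \<mu>] by (intro AE_prob_1) simp
      \<comment> \<open>\<open>\<mu>\<close> is thus a finite combination of Dirac masses at the
        zeros in [0,1), with weights \<open>p\<close>.\<close>
      ultimately have AEZ: "AE x in \<mu>. x \<in> Z" by eventually_elim (simp add: Z_def)
      define p where "p z = measure \<mu> {z}" for z
      have intf: "(LINT x|\<mu>. f x) = (\<Sum>z\<in>Z. p z * f z)" if f: "f \<in> C_circle 0" for f
      proof -
        have "(LINT x|\<mu>. f x) = (LINT x|\<mu>. (\<Sum>z\<in>Z. f z * indicator {z} x))"
        proof (rule integral_cong_AE)
          show "f \<in> borel_measurable \<mu>" using P_circle_integrable[OF \<mu> f] by simp
          show "(\<lambda>x. \<Sum>z\<in>Z. f z * indicator {z} x) \<in> borel_measurable \<mu>"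
            by (intro borel_measurable_sum borel_measurable_times borel_measurable_indicator sets) auto
          show "AE x in \<mu>. f x = (\<Sum>z\<in>Z. f z * indicator {z} x)"
            using AEZ
          proof eventually_elim
            case (elim x)
            have "(\<Sum>z\<in>Z. f z * indicator {z} x) = (\<Sum>z\<in>Z. if z = x then f z else 0)"
              by (intro sum.cong) (auto simp: indicator_def)
            then show ?case using Z elim by simp
          qed
        qed
        also have "\<dots> = (\<Sum>z\<in>Z. (LINT x|\<mu>. f z * indicator {z} x))"
          by (intro Bochner_Integration.integral_sum integrable_mult_right integrable_real_indicator sets)
            (auto simp: emeasure_eq_measure)
        also have "\<dots> = (\<Sum>z\<in>Z. p z * f z)"
          by (intro sum.cong refl) (simp add: p_def mult.commute sets)
        finally show ?thesis .
      qed
      have p1: "sum p Z = 1" using intf[OF C_circle_0_const[of 1]] prob_space by simp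
      have p0: "p z \<ge> 0" for z by (simp add: p_def)
      have bZ: "b z = 0" if "z \<in> Z" for z using that by (simp add: Z_def)
      have e': "e k > 0" "e \<longlonglongrightarrow> 0" for k using e by auto
      obtain \<nu> where \<nu>: "\<And>k. \<nu> k \<in> P_circle"
        "\<And>f. f \<in> C_circle 0 \<Longrightarrow> (\<lambda>k. LINT x|\<nu> k. f x) \<longlonglongrightarrow> (\<Sum>z\<in>Z. p z * f z)"
        "\<And>d. d > 0 \<Longrightarrow> \<forall>\<^sub>F k in sequentially. I_fun a b (e k) (\<nu> k) \<le> ereal ((\<Sum>z\<in>Z. p z * max 0 (nderiv 1 b z)) + d)"
        by (rule recovery_sequence[OF aC2 a0 b Z(1) bZ p0 p1 e'], assumption) (rule that, blast+)
      \<comment> \<open>The test function c = (b')^+ makes c - (b')^+ vanish at every zero, so its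
        \<open>Lambda\<close> is 0 and \<open>J_fun\<close> is at least the recovery cost.\<close>
      have cC: "(\<lambda>x. max 0 (nderiv 1 b x)) \<in> C_circle 0" by (intro C_circle_0_arith C_circle_0_const bC)
      have "max_zero_value b (\<lambda>x. max 0 (nderiv 1 b x)) = 0"
        unfolding max_zero_value_def Z_def[symmetric] using Z by (simp add: image_constant_conv)
      then have J: "ereal (\<Sum>z\<in>Z. p z * max 0 (nderiv 1 b z)) \<le> J_fun a b \<mu>"
        using J_fun_ge[OF cC, of \<mu> a b] by (simp add: L[OF cC] intf[OF cC] del: One_nat_def)
      have "limsup (\<lambda>k. I_fun a b (e k) (\<nu> k)) \<le> ereal (\<Sum>z\<in>Z. p z * max 0 (nderiv 1 b z))"
      proof (rule ereal_le_epsilon2)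
        fix d :: real assume "d > 0"
        then show "limsup (\<lambda>k. I_fun a b (e k) (\<nu> k)) \<le> ereal (\<Sum>z\<in>Z. p z * max 0 (nderiv 1 b z)) + ereal d"
          using \<nu>(3) by (intro Limsup_bounded) simp
      qed
      with J have "limsup (\<lambda>k. I_fun a b (e k) (\<nu> k)) \<le> J_fun a b \<mu>" by (rule order_trans[rotated])
      moreover have "weak_conv_circle \<nu> \<mu>" using \<nu>(2) intf by (simp add: weak_conv_circle_def)
      ultimately show ?thesis using \<nu>(1) by blast
    qed
  qed
qed

end
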